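(* Let $G$ be a locally profinite group, $G^\natural$ a $G$-twisted space and $\omega$ a character of $G$. Suppose given a fundamental system $\mathcal K$ of neighborhoods of $1$ in $G$ consisting of open compact subgroups $K$ of $G$ such that $\omega|_K=1$ and ${\rm Int}_{G^\natural}(\delta_K)(K)=K$ for some $\delta_K\in G^\natural$ (depending on $K$). (1) A smooth $\omega$-representation $(\Pi,V)$ of $G^\natural$ is irreducible if and only if $V\ne0$ and for every $K\in\mathcal K$, the $(\mathcal H_K^\natural,\omega)$-module $V^K$ is zero or simple. (2) Let $(\Pi_1,V_1)$ and $(\Pi_2,V_2)$ be two irreducible smooth $\omega$-representations of $G^\natural$, and $K\in\mathcal K$ such that $V_i^K\ne0$ for $i=1,2$. Then the $\omega$-representations $\Pi_1$ and $\Pi_2$ are isomorphic if and only if the $(\mathcal H_K^\natural,\omega)$-modules $V_1^K$ and $V_2^K$ are isomorphic.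
   Context: A $G$-twisted space is a topological space $G^\natural$ with a continuous left action of $G$ such that $g\mapsto g\cdot\delta$ is a homeomorphism $G\to G^\natural$ for each $\delta$, together with a map ${\rm Int}_{G^\natural}:G^\natural\to{\rm Aut}(G)$ with ${\rm Int}_{G^\natural}(g\cdot\delta)={\rm Int}_G(g)\circ{\rm Int}_{G^\natural}(\delta)$; the right action is $\delta\cdot g={\rm Int}_{G^\natural}(\delta)(g)\cdot\delta$. Characters are continuous morphisms to $\mathbb C^\times$. A smooth $\omega$-representation of $G^\natural$ is a smooth complex representation $(\pi,V)$ of $G$ with a map $\Pi:G^\natural\to{\rm Aut}_{\mathbb C}(V)$ with $\Pi(x\cdot\gamma\cdot y)=\omega(y)\pi(x)\Pi(\gamma)\pi(y)$. Morphisms are linear maps commuting with all $\Pi(\gamma)$, $\gamma\in G^\natural$. It is irreducible if $V\neq 0$ and the only nonzero subspace $V'$ with $\Pi(\delta)(V')=V'$ for all $\delta\in G^\natural$ is $V$. Fix a left Haar measure $d_lg$ on $G$ and let $d_l\delta$ be its image on $G^\natural$ under $g\mapsto\delta_0\cdot g$ (independent of $\delta_0\in G^\natural$). For an open compact subgroup $K$ of $G$ with $\omega|_K=1$: $\mathcal H_K=C_{\rm c}(K\backslash G/K)$ is the Hecke algebra with convolution $f*f'(x)=\int_Gf(g)f'(g^{-1}x)d_lg$; $\mathcal H_K^\natural=C_{\rm c}(K\backslash G^\natural/K)$ is the $\mathcal H_K$-bimodule with $f*\phi(\delta)=\int_Gf(g)\phi(g^{-1}\cdot\delta)d_lg$ and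 $\phi*f(\delta)=\int_G\phi(\delta\cdot g)f(g^{-1})d_lg$. An $(\mathcal H_K^\natural,\omega)$-module is a left $\mathcal H_K$-module $W$ with a linear map $\mathcal H_K^\natural\to{\rm End}_{\mathbb C}(W)$, $\phi\mapsto(w\mapsto\phi\cdot w)$, with $(f*\phi*f')\cdot w=f\cdot(\phi\cdot(\omega f'\cdot w))$ for $f,f'\in\mathcal H_K$, $\phi\in\mathcal H_K^\natural$, where $\omega f'$ is the pointwise product. Morphisms are $\mathcal H_K$-linear maps commuting with the action of $\mathcal H_K^\natural$. $W$ is non-degenerate if $\mathcal H_K^\natural\cdot W=W$. A nonzero non-degenerate $W$ is simple if the only nonzero $\mathcal H_K$-submodule $W'$ of $W$ with $\mathcal H_K^\natural\cdot W'=W'$ is $W$ itself. ($\mathcal H_K^\natural\cdot W$ denotes the span of the $\phi\cdot w$.) For $(\Pi,V)$ smooth, $V^K$ (the $K$-fixed vectors) is an $(\mathcal H_K^\natural,\omega)$-module via $f\cdot v=\int_Gf(g)\pi(g)v\,d_lg$ and $\phi\cdot v=\int_{G^\natural}\phi(\delta)\Pi(\delta)v\,d_l\delta$. *)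

theory Defs
  imports "HOL-Analysis.Analysis" "HOL-Algebra.Group"
begin

section \<open>Locally profinite groups\<close>

record 'g top_group = "'g monoid" +
  grp_top :: "'g topology"

definition topological_group :: "'g top_group \<Rightarrow> bool" where
  "topological_group G \<longleftrightarrow>
     group G \<and> topspace (grp_top G) = carrier G \<and>
     continuous_map (prod_topology (grp_top G) (grp_top G)) (grp_top G)
       (\<lambda>(x, y). x \<otimes>\<^bsub>G\<^esub> y) \<and>
     continuous_map (grp_top G) (grp_top G) (\<lambda>x. inv\<^bsub>G\<^esub> x)"

definition compact_open_subgroup :: "'g top_group \<Rightarrow> 'g set \<Rightarrow> bool" where
  "compact_open_subgroup G K \<longleftrightarrow>
     subgroup K G \<and> openin (grp_top G) K \<and> compactin (grp_top G) K"

definition locally_profinite :: "'g top_group \<Rightarrow> bool" where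
  "locally_profinite G \<longleftrightarrow>
     topological_group G \<and> Hausdorff_space (grp_top G) \<and>
     (\<forall>U. openin (grp_top G) U \<and> \<one>\<^bsub>G\<^esub> \<in> U \<longrightarrow> (\<exists>K. compact_open_subgroup G K \<and> K \<subseteq> U))"

definition grp_character :: "'g top_group \<Rightarrow> ('g \<Rightarrow> complex) \<Rightarrow> bool" where
  "grp_character G \<omega> \<longleftrightarrow>
     continuous_map (grp_top G) (top_of_set (UNIV - {0})) \<omega> \<and>
     (\<forall>x\<in>carrier G. \<forall>y\<in>carrier G. \<omega> (x \<otimes>\<^bsub>G\<^esub> y) = \<omega> x * \<omega> y)"

text \<open>Borel sets and Haar measures relative to an explicit topology (the library's
  \<^const>\<open>borel\<close> is tied to the type class of topological spaces).\<close>

definition borel_on :: "'a topology \<Rightarrow> 'a measure" where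
  "borel_on T = sigma (topspace T) {U. openin T U}"

definition left_haar_measure :: "'g top_group \<Rightarrow> 'g measure \<Rightarrow> bool" where
  "left_haar_measure G M \<longleftrightarrow>
     space M = carrier G \<and> sets M = sets (borel_on (grp_top G)) \<and>
     emeasure M (carrier G) \<noteq> 0 \<and>
     (\<forall>C. compactin (grp_top G) C \<and> C \<in> sets M \<longrightarrow> emeasure M C < \<infinity>) \<and>
     (\<forall>A\<in>sets M. emeasure M A = (INF U\<in>{U. openin (grp_top G) U \<and> A \<subseteq> U}. emeasure M U)) \<and>
     (\<forall>U. openin (grp_top G) U \<longrightarrow>
        emeasure M U =
          (SUP C\<in>{C. compactin (grp_top G) C \<and> C \<in> sets M \<and> C \<subseteq> U}. emeasure M C)) \<and>
     (\<forall>g\<in>carrier G. \<forall>A\<in>sets M. emeasure M ((\<lambda>x. g \<otimes>\<^bsub>G\<^esub> x) ` A) = emeasure M A)"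


section \<open>Twisted spaces\<close>

record ('g, 'x) twisted =
  tw_top :: "'x topology"
  tw_act :: "'g \<Rightarrow> 'x \<Rightarrow> 'x"
  tw_int :: "'x \<Rightarrow> 'g \<Rightarrow> 'g"

abbreviation tw_points :: "('g, 'x) twisted \<Rightarrow> 'x set" where
  "tw_points X \<equiv> topspace (tw_top X)"

text \<open>Automorphisms of a topological group are understood to be homeomorphisms.\<close>

definition twisted_space :: "'g top_group \<Rightarrow> ('g, 'x) twisted \<Rightarrow> bool" where
  "twisted_space G X \<longleftrightarrow>
     continuous_map (prod_topology (grp_top G) (tw_top X)) (tw_top X)
       (\<lambda>(g, \<delta>). tw_act X g \<delta>) \<and>
     (\<forall>\<delta>\<in>tw_points X. tw_act X \<one>\<^bsub>G\<^esub> \<delta> = \<delta>) \<and>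
     (\<forall>g\<in>carrier G. \<forall>h\<in>carrier G. \<forall>\<delta>\<in>tw_points X.
        tw_act X (g \<otimes>\<^bsub>G\<^esub> h) \<delta> = tw_act X g (tw_act X h \<delta>)) \<and>
     (\<forall>\<delta>\<in>tw_points X. homeomorphic_map (grp_top G) (tw_top X) (\<lambda>g. tw_act X g \<delta>)) \<and>
     (\<forall>\<delta>\<in>tw_points X.
        tw_int X \<delta> \<in> iso G G \<and> homeomorphic_map (grp_top G) (grp_top G) (tw_int X \<delta>)) \<and>
     (\<forall>g\<in>carrier G. \<forall>\<delta>\<in>tw_points X. \<forall>x\<in>carrier G.
        tw_int X (tw_act X g \<delta>) x = g \<otimes>\<^bsub>G\<^esub> tw_int X \<delta> x \<otimes>\<^bsub>G\<^esub> inv\<^bsub>G\<^esub> g)"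

definition tw_ract :: "('g, 'x) twisted \<Rightarrow> 'x \<Rightarrow> 'g \<Rightarrow> 'x" where
  "tw_ract X \<delta> g = tw_act X (tw_int X \<delta> g) \<delta>"

text \<open>The image measure does not depend on the base point, so an arbitrary one is chosen.\<close>

definition tw_measure :: "('g, 'x) twisted \<Rightarrow> 'g measure \<Rightarrow> 'x measure" where
  "tw_measure X M =
     distr M (borel_on (tw_top X)) (\<lambda>g. tw_ract X (SOME \<delta>\<^sub>0. \<delta>\<^sub>0 \<in> tw_points X) g)"


section \<open>Smooth representations\<close>

text \<open>The complex vector space \<open>V\<close> is the whole type \<open>'v\<close> with an explicit scalar
  multiplication.\<close>

record ('g, 'x, 'v) tw_rep =
  rep_scale :: "complex \<Rightarrow> 'v \<Rightarrow> 'v"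
  rep_grp :: "'g \<Rightarrow> 'v \<Rightarrow> 'v"
  rep_tw :: "'x \<Rightarrow> 'v \<Rightarrow> 'v"

definition smooth_rep ::
  "'g top_group \<Rightarrow> (complex \<Rightarrow> 'v \<Rightarrow> 'v) \<Rightarrow> ('g \<Rightarrow> 'v \<Rightarrow> 'v::ab_group_add) \<Rightarrow> bool" where
  "smooth_rep G sc \<pi> \<longleftrightarrow>
     vector_space sc \<and>
     (\<forall>g\<in>carrier G. Vector_Spaces.linear sc sc (\<pi> g)) \<and>
     (\<forall>v. \<pi> \<one>\<^bsub>G\<^esub> v = v) \<and>
     (\<forall>g\<in>carrier G. \<forall>h\<in>carrier G. \<forall>v. \<pi> (g \<otimes>\<^bsub>G\<^esub> h) v = \<pi> g (\<pi> h v)) \<and>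
     (\<forall>v. openin (grp_top G) {g \<in> carrier G. \<pi> g v = v})"

definition smooth_omega_rep ::
  "'g top_group \<Rightarrow> ('g, 'x) twisted \<Rightarrow> ('g \<Rightarrow> complex) \<Rightarrow>
   ('g, 'x, 'v::ab_group_add) tw_rep \<Rightarrow> bool" where
  "smooth_omega_rep G X \<omega> R \<longleftrightarrow>
     smooth_rep G (rep_scale R) (rep_grp R) \<and>
     (\<forall>\<gamma>\<in>tw_points X.
        Vector_Spaces.linear (rep_scale R) (rep_scale R) (rep_tw R \<gamma>) \<and> bij (rep_tw R \<gamma>)) \<and>
     (\<forall>x\<in>carrier G. \<forall>\<gamma>\<in>tw_points X. \<forall>y\<in>carrier G. \<forall>v.
        rep_tw R (tw_ract X (tw_act X x \<gamma>) y) v =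
        rep_scale R (\<omega> y) (rep_grp R x (rep_tw R \<gamma> (rep_grp R y v))))"

definition rep_irreducible ::
  "('g, 'x) twisted \<Rightarrow> ('g, 'x, 'v::ab_group_add) tw_rep \<Rightarrow> bool" where
  "rep_irreducible X R \<longleftrightarrow>
     (UNIV :: 'v set) \<noteq> {0} \<and>
     (\<forall>V'. module.subspace (rep_scale R) V' \<and> V' \<noteq> {0} \<and>
        (\<forall>\<delta>\<in>tw_points X. rep_tw R \<delta> ` V' = V') \<longrightarrow> V' = UNIV)"

definition rep_morphism ::
  "('g, 'x) twisted \<Rightarrow> ('g, 'x, 'v::ab_group_add) tw_rep \<Rightarrow>
   ('g, 'x, 'w::ab_group_add) tw_rep \<Rightarrow> ('v \<Rightarrow> 'w) \<Rightarrow> bool" where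
  "rep_morphism X R1 R2 A \<longleftrightarrow>
     Vector_Spaces.linear (rep_scale R1) (rep_scale R2) A \<and>
     (\<forall>\<gamma>\<in>tw_points X. \<forall>v. A (rep_tw R1 \<gamma> v) = rep_tw R2 \<gamma> (A v))"

definition rep_isomorphic ::
  "('g, 'x) twisted \<Rightarrow> ('g, 'x, 'v::ab_group_add) tw_rep \<Rightarrow>
   ('g, 'x, 'w::ab_group_add) tw_rep \<Rightarrow> bool" where
  "rep_isomorphic X R1 R2 \<longleftrightarrow> (\<exists>A. rep_morphism X R1 R2 A \<and> bij A)"


section \<open>Hecke algebras and twisted Hecke bimodules\<close>

text \<open>Functions on \<open>G\<close> and on the twisted space are extended by \<open>0\<close> outside the carrier,
  so that distinct elements of these sets are distinct functions on the carrier.\<close>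

definition hecke :: "'g top_group \<Rightarrow> 'g set \<Rightarrow> ('g \<Rightarrow> complex) set" where
  "hecke G K = {f.
     continuous_map (grp_top G) euclidean f \<and>
     (\<exists>C. compactin (grp_top G) C \<and> (\<forall>x. x \<notin> C \<longrightarrow> f x = 0)) \<and>
     (\<forall>k\<in>K. \<forall>x\<in>carrier G. \<forall>k'\<in>K. f (k \<otimes>\<^bsub>G\<^esub> x \<otimes>\<^bsub>G\<^esub> k') = f x)}"

definition tw_hecke :: "('g, 'x) twisted \<Rightarrow> 'g set \<Rightarrow> ('x \<Rightarrow> complex) set" where
  "tw_hecke X K = {\<phi>.
     continuous_map (tw_top X) euclidean \<phi> \<and>
     (\<exists>C. compactin (tw_top X) C \<and> (\<forall>\<delta>. \<delta> \<notin> C \<longrightarrow> \<phi> \<delta> = 0)) \<and>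
     (\<forall>k\<in>K. \<forall>\<delta>\<in>tw_points X. \<forall>k'\<in>K. \<phi> (tw_ract X (tw_act X k \<delta>) k') = \<phi> \<delta>)}"

definition hecke_conv ::
  "'g top_group \<Rightarrow> 'g measure \<Rightarrow> ('g \<Rightarrow> complex) \<Rightarrow> ('g \<Rightarrow> complex) \<Rightarrow> 'g \<Rightarrow> complex" where
  "hecke_conv G M f f' x =
     (if x \<in> carrier G then LINT g|M. f g * f' (inv\<^bsub>G\<^esub> g \<otimes>\<^bsub>G\<^esub> x) else 0)"

definition hecke_lconv ::
  "'g top_group \<Rightarrow> ('g, 'x) twisted \<Rightarrow> 'g measure \<Rightarrow>
   ('g \<Rightarrow> complex) \<Rightarrow> ('x \<Rightarrow> complex) \<Rightarrow> 'x \<Rightarrow> complex" where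
  "hecke_lconv G X M f \<phi> \<delta> =
     (if \<delta> \<in> tw_points X then LINT g|M. f g * \<phi> (tw_act X (inv\<^bsub>G\<^esub> g) \<delta>) else 0)"

definition hecke_rconv ::
  "'g top_group \<Rightarrow> ('g, 'x) twisted \<Rightarrow> 'g measure \<Rightarrow>
   ('x \<Rightarrow> complex) \<Rightarrow> ('g \<Rightarrow> complex) \<Rightarrow> 'x \<Rightarrow> complex" where
  "hecke_rconv G X M \<phi> f \<delta> =
     (if \<delta> \<in> tw_points X then LINT g|M. \<phi> (tw_ract X \<delta> g) * f (inv\<^bsub>G\<^esub> g) else 0)"

definition hecke_unit :: "'g measure \<Rightarrow> 'g set \<Rightarrow> 'g \<Rightarrow> complex" where
  "hecke_unit M K x = (if x \<in> K then complex_of_real (1 / measure M K) else 0)"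


section \<open>Modules over the twisted Hecke bimodule\<close>

text \<open>A module lives on a subspace \<open>W\<close> (the carrier) of an ambient complex vector space.
  The values of the action maps outside \<open>W\<close>, or on functions outside the Hecke spaces, are
  irrelevant.\<close>

record ('g, 'x, 'w) tw_mod =
  mod_scale :: "complex \<Rightarrow> 'w \<Rightarrow> 'w"
  mod_carrier :: "'w set"
  mod_hecke :: "('g \<Rightarrow> complex) \<Rightarrow> 'w \<Rightarrow> 'w"
  mod_tw :: "('x \<Rightarrow> complex) \<Rightarrow> 'w \<Rightarrow> 'w"

text \<open>\<open>bilinear_action sc F W a\<close>: \<open>a\<close> restricts to a linear map from the function space
  \<open>F\<close> to the endomorphisms of \<open>W\<close>.\<close>

definition bilinear_action ::
  "(complex \<Rightarrow> 'w \<Rightarrow> 'w) \<Rightarrow> ('a \<Rightarrow> complex) set \<Rightarrow> 'w set \<Rightarrow>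
   (('a \<Rightarrow> complex) \<Rightarrow> 'w \<Rightarrow> 'w::ab_group_add) \<Rightarrow> bool" where
  "bilinear_action sc F W a \<longleftrightarrow>
     (\<forall>f\<in>F. \<forall>w\<in>W. a f w \<in> W) \<and>
     (\<forall>f\<in>F. \<forall>w\<in>W. \<forall>w'\<in>W. a f (w + w') = a f w + a f w') \<and>
     (\<forall>f\<in>F. \<forall>c. \<forall>w\<in>W. a f (sc c w) = sc c (a f w)) \<and>
     (\<forall>f\<in>F. \<forall>f'\<in>F. \<forall>w\<in>W. a (\<lambda>x. f x + f' x) w = a f w + a f' w) \<and>
     (\<forall>f\<in>F. \<forall>c. \<forall>w\<in>W. a (\<lambda>x. c * f x) w = sc c (a f w))"

definition hecke_module ::
  "'g top_group \<Rightarrow> 'g measure \<Rightarrow> 'g set \<Rightarrow> (complex \<Rightarrow> 'w \<Rightarrow> 'w) \<Rightarrow> 'w set \<Rightarrow>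
   (('g \<Rightarrow> complex) \<Rightarrow> 'w \<Rightarrow> 'w::ab_group_add) \<Rightarrow> bool" where
  "hecke_module G M K sc W a \<longleftrightarrow>
     vector_space sc \<and> module.subspace sc W \<and>
     bilinear_action sc (hecke G K) W a \<and>
     (\<forall>f\<in>hecke G K. \<forall>f'\<in>hecke G K. \<forall>w\<in>W. a (hecke_conv G M f f') w = a f (a f' w)) \<and>
     (\<forall>w\<in>W. a (hecke_unit M K) w = w)"

definition tw_module ::
  "'g top_group \<Rightarrow> ('g, 'x) twisted \<Rightarrow> 'g measure \<Rightarrow> ('g \<Rightarrow> complex) \<Rightarrow> 'g set \<Rightarrow>
   ('g, 'x, 'w::ab_group_add) tw_mod \<Rightarrow> bool" where
  "tw_module G X M \<omega> K W \<longleftrightarrow>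
     hecke_module G M K (mod_scale W) (mod_carrier W) (mod_hecke W) \<and>
     bilinear_action (mod_scale W) (tw_hecke X K) (mod_carrier W) (mod_tw W) \<and>
     (\<forall>f\<in>hecke G K. \<forall>\<phi>\<in>tw_hecke X K. \<forall>f'\<in>hecke G K. \<forall>w\<in>mod_carrier W.
        mod_tw W (hecke_rconv G X M (hecke_lconv G X M f \<phi>) f') w =
        mod_hecke W f (mod_tw W \<phi> (mod_hecke W (\<lambda>x. \<omega> x * f' x) w)))"

definition tw_span ::
  "('g, 'x) twisted \<Rightarrow> 'g set \<Rightarrow> ('g, 'x, 'w::ab_group_add) tw_mod \<Rightarrow> 'w set \<Rightarrow> 'w set" where
  "tw_span X K W W' = module.span (mod_scale W) {mod_tw W \<phi> w | \<phi> w. \<phi> \<in> tw_hecke X K \<and> w \<in> W'}"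

definition nondegenerate ::
  "('g, 'x) twisted \<Rightarrow> 'g set \<Rightarrow> ('g, 'x, 'w::ab_group_add) tw_mod \<Rightarrow> bool" where
  "nondegenerate X K W \<longleftrightarrow> tw_span X K W (mod_carrier W) = mod_carrier W"

definition hecke_submodule ::
  "'g top_group \<Rightarrow> 'g set \<Rightarrow> ('g, 'x, 'w::ab_group_add) tw_mod \<Rightarrow> 'w set \<Rightarrow> bool" where
  "hecke_submodule G K W W' \<longleftrightarrow>
     W' \<subseteq> mod_carrier W \<and> module.subspace (mod_scale W) W' \<and>
     (\<forall>f\<in>hecke G K. \<forall>w\<in>W'. mod_hecke W f w \<in> W')"

definition simple_tw_module ::
  "'g top_group \<Rightarrow> ('g, 'x) twisted \<Rightarrow> 'g measure \<Rightarrow> ('g \<Rightarrow> complex) \<Rightarrow> 'g set \<Rightarrow>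
   ('g, 'x, 'w::ab_group_add) tw_mod \<Rightarrow> bool" where
  "simple_tw_module G X M \<omega> K W \<longleftrightarrow>
     tw_module G X M \<omega> K W \<and> mod_carrier W \<noteq> {0} \<and> nondegenerate X K W \<and>
     (\<forall>W'. hecke_submodule G K W W' \<and> W' \<noteq> {0} \<and> tw_span X K W W' = W' \<longrightarrow>
        W' = mod_carrier W)"

definition tw_module_morphism ::
  "'g top_group \<Rightarrow> ('g, 'x) twisted \<Rightarrow> 'g set \<Rightarrow> ('g, 'x, 'v::ab_group_add) tw_mod \<Rightarrow>
   ('g, 'x, 'w::ab_group_add) tw_mod \<Rightarrow> ('v \<Rightarrow> 'w) \<Rightarrow> bool" where
  "tw_module_morphism G X K W1 W2 A \<longleftrightarrow>
     A ` mod_carrier W1 \<subseteq> mod_carrier W2 \<and>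
     (\<forall>v\<in>mod_carrier W1. \<forall>w\<in>mod_carrier W1. A (v + w) = A v + A w) \<and>
     (\<forall>c. \<forall>w\<in>mod_carrier W1. A (mod_scale W1 c w) = mod_scale W2 c (A w)) \<and>
     (\<forall>f\<in>hecke G K. \<forall>w\<in>mod_carrier W1. A (mod_hecke W1 f w) = mod_hecke W2 f (A w)) \<and>
     (\<forall>\<phi>\<in>tw_hecke X K. \<forall>w\<in>mod_carrier W1. A (mod_tw W1 \<phi> w) = mod_tw W2 \<phi> (A w))"

definition tw_module_isomorphic ::
  "'g top_group \<Rightarrow> ('g, 'x) twisted \<Rightarrow> 'g set \<Rightarrow> ('g, 'x, 'v::ab_group_add) tw_mod \<Rightarrow>
   ('g, 'x, 'w::ab_group_add) tw_mod \<Rightarrow> bool" where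
  "tw_module_isomorphic G X K W1 W2 \<longleftrightarrow>
     (\<exists>A. tw_module_morphism G X K W1 W2 A \<and> bij_betw A (mod_carrier W1) (mod_carrier W2))"


section \<open>The module of fixed vectors\<close>

text \<open>The integral of a locally constant, compactly supported function with values in a
  vector space without topology: such a function takes finitely many nonzero values, each on
  a compact open set.\<close>

definition lc_integral ::
  "'a measure \<Rightarrow> (complex \<Rightarrow> 'v \<Rightarrow> 'v) \<Rightarrow> ('a \<Rightarrow> 'v::ab_group_add) \<Rightarrow> 'v" where
  "lc_integral N sc F =
     (\<Sum>v\<in>F ` space N - {0}. sc (complex_of_real (measure N {x \<in> space N. F x = v})) v)"

definition fixed_vectors :: "('g, 'x, 'v) tw_rep \<Rightarrow> 'g set \<Rightarrow> 'v set" where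
  "fixed_vectors R K = {v. \<forall>k\<in>K. rep_grp R k v = v}"

definition fixed_module ::
  "('g, 'x) twisted \<Rightarrow> 'g measure \<Rightarrow> ('g, 'x, 'v::ab_group_add) tw_rep \<Rightarrow> 'g set \<Rightarrow>
   ('g, 'x, 'v) tw_mod" where
  "fixed_module X M R K =
     \<lparr> mod_scale = rep_scale R,
       mod_carrier = fixed_vectors R K,
       mod_hecke = (\<lambda>f v. lc_integral M (rep_scale R)
                       (\<lambda>g. rep_scale R (f g) (rep_grp R g v))),
       mod_tw = (\<lambda>\<phi> v. lc_integral (tw_measure X M) (rep_scale R)
                       (\<lambda>\<delta>. rep_scale R (\<phi> \<delta>) (rep_tw R \<delta> v))) \<rparr>"

end

theory Submission
  imports Defs "HOL-Algebra.Coset"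
begin

text \<open>
  Let \<open>K\<close> be one of the given compact open subgroups and \<open>\<delta>\<close> a point of the twisted space that
  normalizes it. Writing points as \<open>\<delta> g\<close> identifies the twisted Hecke bimodule with the
  Hecke algebra, and since \<open>\<Pi>(\<delta> g) = \<omega>(g) \<Pi>(\<delta>) \<pi>(g)\<close>, a function \<open>\<phi>\<close> acts on a vector fixed by \<open>K\<close>
  as the Hecke operator of \<open>g \<mapsto> \<omega>(g) \<phi>(\<delta> g)\<close> followed by \<open>T = \<Pi>(\<delta>)\<close> (\<open>mod_tw_pull\<close>). The operator
  \<open>T\<close> is a bijection of the fixed vectors, and it is the action of the function that corresponds
  to the unit. Hence a simple module is one without proper nonzero Hecke submodules \<open>W\<close>
  with \<open>T W = W\<close> (\<open>simple_iff\<close>).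

  In the formal text \<open>\<Pi>(\<gamma>)\<close> is written \<open>\<tau> \<gamma>\<close> and the automorphism of \<open>G\<close> attached to \<open>\<gamma>\<close> is
  written \<open>\<theta> \<gamma>\<close>.

  Such a \<open>W\<close> generates under \<open>G\<close> a subspace stable under all \<open>\<Pi>(\<gamma>)\<close> (\<open>generated_tw_stable\<close>) whose
  fixed vectors are again \<open>W\<close>: the projection onto fixed vectors, which is the action of the unit of the Hecke
  algebra, sends \<open>\<pi>(g) w\<close> to the image of \<open>w\<close> under a Hecke operator (\<open>hecke_span_fixed\<close>). Thus
  irreducibility implies simplicity. Conversely, if all levels are zero or simple, a nonzero
  stable subspace contains any given vector \<open>v\<close>: by smoothness some \<open>K\<close> fixes \<open>v\<close> and a
  nonzero vector of the subspace, and simplicity at that level applies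
  (\<open>simple_imp_contained\<close>).

  For the second part, the graph of an isomorphism of modules of fixed vectors is a submodule, stable
  under \<open>T\<close>, of the fixed vectors of the direct sum. The stable subspace it generates has no other fixed
  vectors, and Goursat's argument (\<open>stable_correspondence\<close>) shows that it is the graph of an
  isomorphism of representations.

  The analytic input is small. All functions in sight are locally constant with compact support,
  so every integral is a finite sum over cosets of an open compact subgroup
  (\<open>lc_integral_adapted\<close>, \<open>Bochner_integral_adapted\<close>), a convolution is a finite combination
  of translates of one factor, and the module laws (\<open>act_conv\<close>, \<open>mod_tw_lconv\<close>, \<open>mod_tw_rconv\<close>)
  are identities between finite sums.
\<close>

section \<open>Cosets of compact open subgroups\<close>

locale haar_group =
  fixes G :: "'g top_group" (structure) and M :: "'g measure"
  assumes locally_profinite: "locally_profinite G"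
    and haar: "left_haar_measure G M"
begin

lemma topgrp: "topological_group G"
  using locally_profinite by (simp add: locally_profinite_def)

sublocale group G
  using topgrp by (simp add: topological_group_def)

lemma topspace_grp [simp]: "topspace (grp_top G) = carrier G"
  using topgrp by (simp add: topological_group_def)

lemma space_haar [simp]: "space M = carrier G"
  using haar unfolding left_haar_measure_def by (rule conjunct1)

lemma inv_mult_cancel [simp]:
  "a \<in> carrier G \<Longrightarrow> x \<in> carrier G \<Longrightarrow> inv a \<otimes> (a \<otimes> x) = x"
  "a \<in> carrier G \<Longrightarrow> x \<in> carrier G \<Longrightarrow> a \<otimes> (inv a \<otimes> x) = x"
  by (simp_all flip: m_assoc)

lemma continuous_left_mult:
  assumes "g \<in> carrier G"
  shows "continuous_map (grp_top G) (grp_top G) (\<lambda>x. g \<otimes> x)"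
proof -
  have "continuous_map (grp_top G) (prod_topology (grp_top G) (grp_top G)) (\<lambda>x. (g, x))"
    using assms by (simp add: continuous_map_pairedI)
  from continuous_map_compose[OF this, of "grp_top G" "\<lambda>(x, y). x \<otimes> y"] topgrp
  show ?thesis by (simp add: topological_group_def o_def)
qed

lemma homeomorphic_left_mult:
  assumes g: "g \<in> carrier G"
  shows "homeomorphic_map (grp_top G) (grp_top G) (\<lambda>x. g \<otimes> x)"
  unfolding homeomorphic_map_maps homeomorphic_maps_def
  using g by (intro exI[of _ "\<lambda>x. inv g \<otimes> x"]) (simp add: continuous_left_mult)

lemma continuous_right_mult:
  assumes "g \<in> carrier G"
  shows "continuous_map (grp_top G) (grp_top G) (\<lambda>x. x \<otimes> g)"
proof -
  have "continuous_map (grp_top G) (prod_topology (grp_top G) (grp_top G)) (\<lambda>x. (x, g))"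
    using assms by (simp add: continuous_map_pairedI)
  from continuous_map_compose[OF this, of "grp_top G" "\<lambda>(x, y). x \<otimes> y"] topgrp
  show ?thesis by (simp add: topological_group_def o_def)
qed

lemma homeomorphic_conjugation:
  assumes g: "g \<in> carrier G"
  shows "homeomorphic_map (grp_top G) (grp_top G) (\<lambda>x. g \<otimes> x \<otimes> inv g)"
proof -
  have "continuous_map (grp_top G) (grp_top G) (\<lambda>x. a \<otimes> x \<otimes> inv a)" if "a \<in> carrier G" for a
    using continuous_map_compose[OF continuous_left_mult[OF that] continuous_right_mult[of "inv a"]] that
    by (simp add: o_def)
  from this[of g] this[of "inv g"] g show ?thesis
    unfolding homeomorphic_map_maps homeomorphic_maps_def
    by (intro exI[of _ "\<lambda>x. inv g \<otimes> x \<otimes> g"]) (simp add: m_assoc)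
qed

lemma compact_open_subgroupD:
  assumes "compact_open_subgroup G K"
  shows "subgroup K G" "openin (grp_top G) K" "compactin (grp_top G) K" "\<one> \<in> K" "K \<subseteq> carrier G"
    "\<And>k. k \<in> K \<Longrightarrow> k \<in> carrier G" "\<And>k. k \<in> K \<Longrightarrow> inv k \<in> K"
    "\<And>k l. k \<in> K \<Longrightarrow> l \<in> K \<Longrightarrow> k \<otimes> l \<in> K"
  using assms
  by (auto simp: compact_open_subgroup_def subgroup.one_closed subgroup.m_inv_closed
      subgroup.m_closed dest: subgroup.mem_carrier)

lemma compact_open_subgroup_below:
  assumes "openin (grp_top G) U" "\<one> \<in> U"
  obtains K where "compact_open_subgroup G K" "K \<subseteq> U"
  using locally_profinite assms unfolding locally_profinite_def by blast

lemma compact_open_subgroup_Int_below: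
  assumes "compact_open_subgroup G K" "openin (grp_top G) U" "\<one> \<in> U"
  obtains L where "compact_open_subgroup G L" "L \<subseteq> K" "L \<subseteq> U"
  using compact_open_subgroup_below[of "K \<inter> U"] assms compact_open_subgroupD[OF assms(1)]
  by (metis IntI le_inf_iff openin_Int)

lemma conjugate_compact_open:
  assumes K: "compact_open_subgroup G K" and g: "g \<in> carrier G"
  shows "openin (grp_top G) ((\<lambda>x. g \<otimes> x \<otimes> inv g) ` K)" "\<one> \<in> (\<lambda>x. g \<otimes> x \<otimes> inv g) ` K"
proof -
  show "openin (grp_top G) ((\<lambda>x. g \<otimes> x \<otimes> inv g) ` K)"
    using homeomorphic_imp_open_map[OF homeomorphic_conjugation[OF g]] compact_open_subgroupD(2)[OF K]
    unfolding open_map_def by blast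
  have "\<one> = g \<otimes> \<one> \<otimes> inv g" using g by simp
  thus "\<one> \<in> (\<lambda>x. g \<otimes> x \<otimes> inv g) ` K" using compact_open_subgroupD(4)[OF K] by (rule image_eqI)
qed

abbreviation lcos :: "'g \<Rightarrow> 'g set \<Rightarrow> 'g set" where
  "lcos x K \<equiv> l_coset G x K"

lemma l_coset_image: "lcos x K = (\<lambda>y. x \<otimes> y) ` K"
  by (auto simp: l_coset_def)

lemma
  assumes "compact_open_subgroup G K" "x \<in> carrier G"
  shows openin_l_coset: "openin (grp_top G) (lcos x K)"
    and compactin_l_coset: "compactin (grp_top G) (lcos x K)"
    and mem_l_coset_self: "x \<in> lcos x K"
    and l_coset_in_carrier: "lcos x K \<subseteq> carrier G"
proof -
  note K = compact_open_subgroupD[OF assms(1)]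
  show "openin (grp_top G) (lcos x K)"
    using homeomorphic_imp_open_map[OF homeomorphic_left_mult[OF assms(2)]] K
    unfolding l_coset_image open_map_def by blast
  show "compactin (grp_top G) (lcos x K)"
    unfolding l_coset_image using image_compactin[OF K(3) continuous_left_mult[OF assms(2)]] .
  show "x \<in> lcos x K" "lcos x K \<subseteq> carrier G" using K assms by (auto simp: l_coset_def intro!: exI[of _ \<one>])
qed

lemma l_coset_eq:
  assumes "compact_open_subgroup G K" "x \<in> carrier G" "y \<in> lcos x K"
  shows "lcos y K = lcos x K"
  using l_repr_independence[OF assms(3,2)] compact_open_subgroupD(1)[OF assms(1)] by simp

text \<open>Distinct representatives of finitely many cosets. Not all of \<open>G/K\<close> is covered: it may be
  infinite, and even uncountable, while a compact set always meets finitely many cosets.\<close>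

definition coset_reps :: "'g set \<Rightarrow> 'g set \<Rightarrow> bool" where
  "coset_reps K S \<longleftrightarrow> finite S \<and> S \<subseteq> carrier G \<and> inj_on (\<lambda>s. lcos s K) S"

lemma coset_reps_disjoint:
  assumes "compact_open_subgroup G K" "coset_reps K S" "s \<in> S" "t \<in> S" "x \<in> lcos s K" "x \<in> lcos t K"
  shows "s = t"
proof -
  have "lcos s K = lcos t K"
    using l_coset_eq[OF assms(1) _ assms(5)] l_coset_eq[OF assms(1) _ assms(6)] assms(2-4)
    by (auto simp: coset_reps_def)
  thus ?thesis using assms(2-4) by (auto simp: coset_reps_def inj_on_def)
qed

lemma coset_reps_exist:
  assumes K: "compact_open_subgroup G K" and C: "compactin (grp_top G) C"
  obtains S where "coset_reps K S" "C \<subseteq> (\<Union>s\<in>S. lcos s K)"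
proof -
  have CG: "C \<subseteq> carrier G" using C by (simp add: compactin_def)
  have "\<forall>U\<in>(\<lambda>x. lcos x K) ` C. openin (grp_top G) U" "C \<subseteq> \<Union>((\<lambda>x. lcos x K) ` C)"
    using CG openin_l_coset[OF K] mem_l_coset_self[OF K] by blast+
  hence "\<exists>\<F>. finite \<F> \<and> \<F> \<subseteq> (\<lambda>x. lcos x K) ` C \<and> C \<subseteq> \<Union>\<F>"
    using C unfolding compactin_def by meson
  then obtain \<F> where F: "finite \<F>" "\<F> \<subseteq> (\<lambda>x. lcos x K) ` C" "C \<subseteq> \<Union>\<F>" by blast
  then obtain S where S: "S \<subseteq> C" "inj_on (\<lambda>x. lcos x K) S" "\<F> = (\<lambda>x. lcos x K) ` S"
    by (metis subset_image_inj)
  show thesis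
  proof (rule that)
    show "coset_reps K S" unfolding coset_reps_def
      using S F(1) CG finite_image_iff[OF S(2)] by auto
    show "C \<subseteq> (\<Union>s\<in>S. lcos s K)" using F(3) S(3) by blast
  qed
qed

section \<open>Haar measure of cosets\<close>

lemma sets_haar: "sets M = sets (borel_on (grp_top G))"
  and haar_nonzero: "emeasure M (carrier G) \<noteq> 0"
  and haar_compact_finite:
    "\<forall>C. compactin (grp_top G) C \<and> C \<in> sets M \<longrightarrow> emeasure M C < \<infinity>"
  and haar_inner_regular: "\<forall>U. openin (grp_top G) U \<longrightarrow> emeasure M U =
          (SUP C\<in>{C. compactin (grp_top G) C \<and> C \<in> sets M \<and> C \<subseteq> U}. emeasure M C)"
  and haar_invariant:
    "\<forall>g\<in>carrier G. \<forall>A\<in>sets M. emeasure M ((\<lambda>x. g \<otimes> x) ` A) = emeasure M A"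
  using haar unfolding left_haar_measure_def by - (elim conjE, assumption)+

lemma open_in_sets: "openin (grp_top G) U \<Longrightarrow> U \<in> sets M"
  using openin_subset[of "grp_top G"]
  by (auto simp: sets_haar borel_on_def sets_measure_of_conv)

lemma haar_translate:
  "g \<in> carrier G \<Longrightarrow> A \<in> sets M \<Longrightarrow> emeasure M ((\<lambda>x. g \<otimes> x) ` A) = emeasure M A"
  using haar_invariant by blast

lemma haar_compact_open_finite:
  "openin (grp_top G) C \<Longrightarrow> compactin (grp_top G) C \<Longrightarrow> emeasure M C < \<infinity>"
  using haar_compact_finite open_in_sets by blast

lemma
  assumes K: "compact_open_subgroup G K" and s: "s \<in> carrier G"
  shows measure_l_coset: "measure M (lcos s K) = measure M K"
    and fmeasurable_l_coset: "lcos s K \<in> fmeasurable M"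
proof -
  show "measure M (lcos s K) = measure M K"
    unfolding measure_def l_coset_image
    using haar_translate[OF s open_in_sets] compact_open_subgroupD(2)[OF K] by simp
  show "lcos s K \<in> fmeasurable M"
    using haar_compact_open_finite[OF openin_l_coset[OF K s] compactin_l_coset[OF K s]]
      open_in_sets[OF openin_l_coset[OF K s]] by (simp add: fmeasurable_def)
qed

text \<open>If \<open>K\<close> were a null set then so would be every compact set, being covered by finitely many
  translates of \<open>K\<close>; inner regularity would then make the Haar measure vanish.\<close>

lemma measure_compact_open_pos:
  assumes K: "compact_open_subgroup G K"
  shows "measure M K > 0"
proof (rule ccontr)
  assume "\<not> 0 < measure M K"
  hence 0: "measure M K = 0" by (simp add: zero_less_measure_iff)
  have null: "emeasure M C = 0" if C: "compactin (grp_top G) C" for C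
  proof -
    obtain S where S: "coset_reps K S" "C \<subseteq> (\<Union>s\<in>S. lcos s K)"
      using coset_reps_exist[OF K C] .
    have "lcos s K \<in> null_sets M" if "s \<in> S" for s
    proof -
      have s: "s \<in> carrier G" using S(1) that by (auto simp: coset_reps_def)
      have "emeasure M (lcos s K) = ennreal (measure M (lcos s K))"
        using fmeasurable_l_coset[OF K s] by (simp add: emeasure_eq_measure2)
      thus ?thesis using measure_l_coset[OF K s] fmeasurable_l_coset[OF K s] 0
        by (simp add: null_setsI fmeasurableD)
    qed
    hence "(\<Union>s\<in>S. lcos s K) \<in> null_sets M"
      using S(1) by (intro null_sets_UN') (auto simp: coset_reps_def countable_finite)
    hence "emeasure M (\<Union>s\<in>S. lcos s K) = 0" by auto
    moreover have "emeasure M C \<le> emeasure M (\<Union>s\<in>S. lcos s K)"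
      using S fmeasurable_l_coset[OF K] 
      by (intro emeasure_mono) (auto simp: coset_reps_def fmeasurable_def)
    ultimately show ?thesis by simp
  qed
  have "openin (grp_top G) (carrier G)"
    using openin_topspace[of "grp_top G"] by simp
  hence "emeasure M (carrier G) =
        (SUP C\<in>{C. compactin (grp_top G) C \<and> C \<in> sets M \<and> C \<subseteq> carrier G}. emeasure M C)"
    using haar_inner_regular by blast
  also have "\<dots> = 0" using null by (intro antisym SUP_least) auto
  finally show False using haar_nonzero by simp
qed

lemma mu_nonzero: "compact_open_subgroup G K \<Longrightarrow> complex_of_real (measure M K) \<noteq> 0"
  using measure_compact_open_pos[of K] by simp

section \<open>Integrals of locally constant functions with compact support\<close>

text \<open>Values outside the carrier are left free, because integrands such as \<open>f (inv g \<otimes> x)\<close> are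
  arbitrary there.\<close>

definition rinv_cpt :: "'g set \<Rightarrow> ('g \<Rightarrow> 'v::zero) \<Rightarrow> bool" where
  "rinv_cpt K F \<longleftrightarrow>
     (\<forall>x\<in>carrier G. \<forall>k\<in>K. F (x \<otimes> k) = F x) \<and>
     (\<exists>C. compactin (grp_top G) C \<and> (\<forall>x\<in>carrier G - C. F x = 0))"

definition smooth_cpt :: "('g \<Rightarrow> 'v::zero) \<Rightarrow> bool" where
  "smooth_cpt F \<longleftrightarrow> (\<exists>K. compact_open_subgroup G K \<and> rinv_cpt K F)"

text \<open>A finite list of cosets that carries \<open>F\<close>. All integrals below become finite sums over such
  an \<open>S\<close>, so that Fubini arguments, for which the Haar measure might fail to be
  \<open>\<sigma>\<close>-finite, are replaced by exchanging finite sums.\<close>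

definition adapted :: "'g set \<Rightarrow> 'g set \<Rightarrow> ('g \<Rightarrow> 'v::zero) \<Rightarrow> bool" where
  "adapted K S F \<longleftrightarrow> compact_open_subgroup G K \<and> coset_reps K S \<and>
     (\<forall>x\<in>carrier G. \<forall>k\<in>K. F (x \<otimes> k) = F x) \<and> (\<forall>x\<in>carrier G - (\<Union>s\<in>S. lcos s K). F x = 0)"

lemma adapted_coset:
  assumes "adapted K S F" "s \<in> S" "x \<in> lcos s K"
  shows "F x = F s"
  using assms by (auto simp: adapted_def l_coset_def coset_reps_def)

lemma adapted_level_set:
  assumes "adapted K S F" "v \<noteq> 0"
  shows "{x \<in> carrier G. F x = v} = (\<Union>s\<in>{s\<in>S. F s = v}. lcos s K)"
proof (rule Set.set_eqI, rule iffI)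
  fix x assume x: "x \<in> {x \<in> carrier G. F x = v}"
  then obtain s where s: "s \<in> S" "x \<in> lcos s K"
    using assms unfolding adapted_def by fastforce
  with x show "x \<in> (\<Union>s\<in>{s\<in>S. F s = v}. lcos s K)"
    using adapted_coset[OF assms(1) s] by auto
next
  fix x assume "x \<in> (\<Union>s\<in>{s\<in>S. F s = v}. lcos s K)"
  then obtain s where s: "s \<in> S" "F s = v" "x \<in> lcos s K" by blast
  have "lcos s K \<subseteq> carrier G" using assms s l_coset_in_carrier by (auto simp: adapted_def coset_reps_def)
  thus "x \<in> {x \<in> carrier G. F x = v}"
    using adapted_coset[OF assms(1) s(1,3)] s by auto
qed

text \<open>The definition of the integral groups the cosets in \<open>S\<close> by the value of \<open>F\<close>; here they are
  summed one by one.\<close>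

lemma lc_integral_adapted:
  assumes "vector_space sc" and F: "adapted K S F"
  shows "lc_integral M sc F = (\<Sum>s\<in>S. sc (complex_of_real (measure M K)) (F s))"
proof -
  interpret vector_space sc by fact
  note K = F[unfolded adapted_def, THEN conjunct1]
  note S = F[unfolded adapted_def, THEN conjunct2, THEN conjunct1]
  have fin: "finite S" using S by (simp add: coset_reps_def)
  have meas: "measure M {x \<in> carrier G. F x = v} = card {s\<in>S. F s = v} * measure M K"
    if "v \<noteq> 0" for v
  proof -
    have "measure M {x \<in> carrier G. F x = v} = (\<Sum>s\<in>{s\<in>S. F s = v}. measure M (lcos s K))"
      proof (subst adapted_level_set[OF F that], rule measure_finite_Union)
      show "finite {s\<in>S. F s = v}" using fin by simp
      show "(\<lambda>s. lcos s K) ` {s\<in>S. F s = v} \<subseteq> sets M"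
        using fmeasurable_l_coset[OF K] S by (auto simp: coset_reps_def fmeasurable_def)
      show "disjoint_family_on (\<lambda>s. lcos s K) {s\<in>S. F s = v}"
        using coset_reps_disjoint[OF K S] unfolding disjoint_family_on_def by blast
      show "emeasure M (lcos s K) \<noteq> \<infinity>" if "s \<in> {s\<in>S. F s = v}" for s
        using fmeasurable_l_coset[OF K, of s] S that by (auto simp: coset_reps_def fmeasurable_def)
    qed
    also have "\<dots> = (\<Sum>s\<in>{s\<in>S. F s = v}. measure M K)"
      using measure_l_coset[OF K] S by (intro sum.cong) (auto simp: coset_reps_def)
    finally show ?thesis by simp
  qed
  let ?m = "complex_of_real (measure M K)"
  have image: "F ` carrier G - {0} = F ` S - {0}"
  proof -
    have "F x \<in> F ` S" if x: "x \<in> carrier G" "F x \<noteq> 0" for x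
    proof -
      have "x \<in> {y \<in> carrier G. F y = F x}" using x by simp
      then obtain s where "s \<in> S" "F s = F x"
        unfolding adapted_level_set[OF F x(2)] by blast
      thus ?thesis by (metis imageI)
    qed
    moreover have "F ` S \<subseteq> F ` carrier G"
      using S unfolding coset_reps_def by (intro image_mono) (elim conjE)
    ultimately show ?thesis by blast
  qed
  have "lc_integral M sc F = (\<Sum>v\<in>F ` S - {0}. \<Sum>s\<in>{s\<in>S. F s = v}. sc ?m (F s))"
    unfolding lc_integral_def space_haar image
  proof (rule sum.cong[OF refl])
    fix v assume "v \<in> F ` S - {0}"
    hence "sc (complex_of_real (measure M {x \<in> carrier G. F x = v})) v
        = sc (\<Sum>s\<in>{s\<in>S. F s = v}. ?m) v"
      using meas[of v] by simp
    also have "\<dots> = (\<Sum>s\<in>{s\<in>S. F s = v}. sc ?m v)"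
      by (rule scale_sum_left)
    finally show "sc (complex_of_real (measure M {x \<in> carrier G. F x = v})) v
        = (\<Sum>s\<in>{s\<in>S. F s = v}. sc ?m (F s))" by simp
  qed
  also have "\<dots> = (\<Sum>v\<in>F ` S. \<Sum>s\<in>{s\<in>S. F s = v}. sc ?m (F s))"
    using fin by (intro sum.mono_neutral_left) auto
  also have "\<dots> = (\<Sum>s\<in>S. sc ?m (F s))"
    using sum.image_gen[OF fin, of "\<lambda>s. sc ?m (F s)" F] by simp
  finally show ?thesis .
qed

lemma rinv_cpt_mono: "rinv_cpt K F \<Longrightarrow> L \<subseteq> K \<Longrightarrow> rinv_cpt L F"
  unfolding rinv_cpt_def by blast

lemma adapted_smooth_cpt:
  assumes "adapted K S F"
  shows "rinv_cpt K F" "smooth_cpt F"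
proof -
  have "compactin (grp_top G) (\<Union>s\<in>S. lcos s K)"
    using assms compactin_l_coset[of K]
    by (intro compactin_Union) (auto simp: adapted_def coset_reps_def)
  thus "rinv_cpt K F" using assms by (auto simp: rinv_cpt_def adapted_def)
  thus "smooth_cpt F" using assms by (auto simp: smooth_cpt_def adapted_def)
qed

text \<open>A common set of representatives is what makes the integral additive.\<close>

lemma adapted_common:
  assumes K: "compact_open_subgroup G K" and F: "rinv_cpt K F" and F': "rinv_cpt K F'"
  obtains S where "adapted K S F" "adapted K S F'"
proof -
  obtain C C' where C: "compactin (grp_top G) C" "\<forall>x\<in>carrier G - C. F x = 0"
    "compactin (grp_top G) C'" "\<forall>x\<in>carrier G - C'. F' x = 0"
    using F F' unfolding rinv_cpt_def by blast
  obtain S where S: "coset_reps K S" "C \<union> C' \<subseteq> (\<Union>s\<in>S. lcos s K)"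
    using coset_reps_exist[OF K compactin_Un[OF C(1,3)]] .
  show thesis
  proof (rule that)
    have "\<forall>x\<in>carrier G - (\<Union>s\<in>S. lcos s K). F x = 0"
      "\<forall>x\<in>carrier G - (\<Union>s\<in>S. lcos s K). F' x = 0"
      using S(2) C(2,4) by (meson DiffD1 DiffD2 DiffI UnCI subsetD)+
    thus "adapted K S F" "adapted K S F'"
      using S(1) K F F' by (simp_all add: adapted_def rinv_cpt_def)
  qed
qed

lemma rinv_cpt_adapted:
  assumes "compact_open_subgroup G K" "rinv_cpt K F"
  obtains S where "adapted K S F"
  by (rule adapted_common[OF assms assms(2)]) (rule that)

lemma smooth_cpt_common_group:
  assumes "smooth_cpt F" "smooth_cpt F'"
  obtains K where "compact_open_subgroup G K" "rinv_cpt K F" "rinv_cpt K F'"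
proof -
  obtain K where K: "compact_open_subgroup G K" "rinv_cpt K F"
    using assms(1) unfolding smooth_cpt_def by (elim exE conjE)
  obtain K' where K': "compact_open_subgroup G K'" "rinv_cpt K' F'"
    using assms(2) unfolding smooth_cpt_def by (elim exE conjE)
  obtain L where L: "compact_open_subgroup G L" "L \<subseteq> K" "L \<subseteq> K'"
    using compact_open_subgroup_Int_below[OF K(1) compact_open_subgroupD(2,4)[OF K'(1)]] .
  show thesis using that[OF L(1) rinv_cpt_mono[OF K(2) L(2)] rinv_cpt_mono[OF K'(2) L(3)]] .
qed

lemma smooth_cpt_common:
  assumes "smooth_cpt F" "smooth_cpt F'"
  obtains K S where "adapted K S F" "adapted K S F'"
proof -
  obtain K where K: "compact_open_subgroup G K" "rinv_cpt K F" "rinv_cpt K F'"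
    using smooth_cpt_common_group[OF assms] .
  show thesis by (rule adapted_common[OF K], rule that)
qed

lemma lc_integral_cong:
  assumes "\<And>x. x \<in> carrier G \<Longrightarrow> F x = F' x"
  shows "lc_integral M sc F = lc_integral M sc F'"
proof -
  have image: "F ` carrier G = F' ` carrier G" using assms by (rule image_cong[OF refl])
  have level: "{x \<in> carrier G. F x = v} = {x \<in> carrier G. F' x = v}" for v using assms by auto
  show ?thesis unfolding lc_integral_def space_haar image level ..
qed

lemma rinv_cpt_cong:
  assumes "compact_open_subgroup G K" "\<And>x. x \<in> carrier G \<Longrightarrow> F x = F' x"
  shows "rinv_cpt K F \<longleftrightarrow> rinv_cpt K F'"
  using assms compact_open_subgroupD(6)[OF assms(1)] by (simp add: rinv_cpt_def)

lemma smooth_cpt_cong: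
  assumes "\<And>x. x \<in> carrier G \<Longrightarrow> F x = F' x"
  shows "smooth_cpt F \<longleftrightarrow> smooth_cpt F'"
  unfolding smooth_cpt_def by (intro ex_cong1 conj_cong refl rinv_cpt_cong assms)

lemma rinv_cpt_add:
  fixes F F' :: "'g \<Rightarrow> 'v::ab_group_add"
  assumes "rinv_cpt K F" "rinv_cpt K F'"
  shows "rinv_cpt K (\<lambda>x. F x + F' x)"
proof -
  obtain C C' where C: "compactin (grp_top G) C" "\<forall>x\<in>carrier G - C. F x = 0"
    "compactin (grp_top G) C'" "\<forall>x\<in>carrier G - C'. F' x = 0"
    using assms unfolding rinv_cpt_def by blast
  have "compactin (grp_top G) (C \<union> C')" "\<forall>x\<in>carrier G - (C \<union> C'). F x + F' x = 0"
    using C compactin_Un by auto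
  moreover have "\<forall>x\<in>carrier G. \<forall>k\<in>K. F (x \<otimes> k) + F' (x \<otimes> k) = F x + F' x"
    using assms unfolding rinv_cpt_def by simp
  ultimately show ?thesis unfolding rinv_cpt_def by blast
qed

lemma
  fixes F F' :: "'g \<Rightarrow> 'v::ab_group_add"
  assumes F: "smooth_cpt F" "smooth_cpt F'"
  shows smooth_cpt_add: "smooth_cpt (\<lambda>x. F x + F' x)"
    and lc_integral_add: "vector_space sc \<Longrightarrow>
      lc_integral M sc (\<lambda>x. F x + F' x) = lc_integral M sc F + lc_integral M sc F'"
proof -
  obtain K S where KS: "adapted K S F" "adapted K S F'" using smooth_cpt_common[OF F] .
  hence sum: "adapted K S (\<lambda>x. F x + F' x)" by (auto simp: adapted_def)
  show "smooth_cpt (\<lambda>x. F x + F' x)" using adapted_smooth_cpt(2)[OF sum] .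
  assume vs: "vector_space sc"
  then interpret vector_space sc .
  show "lc_integral M sc (\<lambda>x. F x + F' x) = lc_integral M sc F + lc_integral M sc F'"
    unfolding lc_integral_adapted[OF vs sum] lc_integral_adapted[OF vs KS(1)]
      lc_integral_adapted[OF vs KS(2)]
    by (simp add: scale_right_distrib sum.distrib)
qed

lemma
  assumes F: "smooth_cpt F" and "Vector_Spaces.linear sc sc' A"
  shows smooth_cpt_linear: "smooth_cpt (\<lambda>x. A (F x))"
    and lc_integral_linear: "lc_integral M sc' (\<lambda>x. A (F x)) = A (lc_integral M sc F)"
proof -
  interpret Vector_Spaces.linear sc sc' A by fact
  obtain K S where KS: "adapted K S F" using smooth_cpt_common[OF F F] by blast
  hence A: "adapted K S (\<lambda>x. A (F x))" by (auto simp: adapted_def)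
  show "smooth_cpt (\<lambda>x. A (F x))" using adapted_smooth_cpt(2)[OF A] .
  show "lc_integral M sc' (\<lambda>x. A (F x)) = A (lc_integral M sc F)"
    unfolding lc_integral_adapted[OF vs1.vector_space_axioms KS]
      lc_integral_adapted[OF vs2.vector_space_axioms A]
    by (simp add: sum scale)
qed

lemma linear_scale_right:
  assumes "vector_space sc"
  shows "Vector_Spaces.linear sc sc (\<lambda>v. sc c v)"
proof -
  interpret vector_space sc by fact
  show ?thesis by (rule linear_scale_self)
qed

lemmas smooth_cpt_scale = smooth_cpt_linear[OF _ linear_scale_right]
lemmas lc_integral_scale = lc_integral_linear[OF _ linear_scale_right]

lemma smooth_cpt_zero: "smooth_cpt (\<lambda>x. 0)"
proof -
  have "openin (grp_top G) (carrier G)" using openin_topspace[of "grp_top G"] by simp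
  then obtain K where "compact_open_subgroup G K"
    using compact_open_subgroup_below[of "carrier G"] by auto
  thus ?thesis unfolding smooth_cpt_def rinv_cpt_def
    by (intro exI[of _ K]) (auto intro: exI[of _ "{}"])
qed

lemma lc_integral_zero: "lc_integral M sc (\<lambda>x. 0) = 0"
  by (simp add: lc_integral_def image_constant_conv)

lemma
  fixes F :: "'i \<Rightarrow> 'g \<Rightarrow> 'v::ab_group_add"
  assumes "finite I" "\<And>i. i \<in> I \<Longrightarrow> smooth_cpt (F i)"
  shows smooth_cpt_sum: "smooth_cpt (\<lambda>x. \<Sum>i\<in>I. F i x)"
    and lc_integral_sum: "vector_space sc \<Longrightarrow>
      lc_integral M sc (\<lambda>x. \<Sum>i\<in>I. F i x) = (\<Sum>i\<in>I. lc_integral M sc (F i))"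
proof -
  have "smooth_cpt (\<lambda>x. \<Sum>i\<in>I. F i x) \<and> (vector_space sc \<longrightarrow>
      lc_integral M sc (\<lambda>x. \<Sum>i\<in>I. F i x) = (\<Sum>i\<in>I. lc_integral M sc (F i)))"
    using assms
    by (induction I rule: finite_induct)
       (auto simp: smooth_cpt_zero lc_integral_zero smooth_cpt_add lc_integral_add)
  thus "smooth_cpt (\<lambda>x. \<Sum>i\<in>I. F i x)" "vector_space sc \<Longrightarrow>
      lc_integral M sc (\<lambda>x. \<Sum>i\<in>I. F i x) = (\<Sum>i\<in>I. lc_integral M sc (F i))" by blast+
qed

lemma open_level_set:
  assumes "smooth_cpt F"
  shows "openin (grp_top G) {x \<in> carrier G. F x \<in> U}"
proof -
  obtain K where K: "compact_open_subgroup G K" "rinv_cpt K F"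
    using assms unfolding smooth_cpt_def by blast
  have "lcos x K \<subseteq> {x \<in> carrier G. F x \<in> U}" if "x \<in> carrier G" "F x \<in> U" for x
    using K l_coset_in_carrier[OF K(1) that(1)] that by (auto simp: rinv_cpt_def l_coset_def)
  hence "\<exists>T. openin (grp_top G) T \<and> x \<in> T \<and> T \<subseteq> {x \<in> carrier G. F x \<in> U}"
    if "x \<in> {x \<in> carrier G. F x \<in> U}" for x
    using that openin_l_coset[OF K(1), of x] mem_l_coset_self[OF K(1), of x] by auto
  thus ?thesis by (subst openin_subopen) (intro ballI)
qed

lemma smooth_cpt_translate:
  assumes "smooth_cpt F" and g: "g \<in> carrier G"
  shows "smooth_cpt (\<lambda>x. F (g \<otimes> x))"
proof -
  obtain K C where K: "compact_open_subgroup G K" "\<forall>x\<in>carrier G. \<forall>k\<in>K. F (x \<otimes> k) = F x"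
    and C: "compactin (grp_top G) C" "\<forall>x\<in>carrier G - C. F x = 0"
    using assms unfolding smooth_cpt_def rinv_cpt_def by blast
  have "compactin (grp_top G) ((\<lambda>x. inv g \<otimes> x) ` C)"
    using image_compactin[OF C(1) continuous_left_mult] g by simp
  moreover have "F (g \<otimes> x) = 0" if "x \<in> carrier G - (\<lambda>x. inv g \<otimes> x) ` C" for x
  proof -
    have "g \<otimes> x \<notin> C"
    proof
      assume "g \<otimes> x \<in> C"
      hence "inv g \<otimes> (g \<otimes> x) \<in> (\<lambda>x. inv g \<otimes> x) ` C" by blast
      thus False using that g by simp
    qed
    thus ?thesis using C(2) that g by simp
  qed
  moreover have "\<forall>x\<in>carrier G. \<forall>k\<in>K. F (g \<otimes> (x \<otimes> k)) = F (g \<otimes> x)"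
    using K(2) g compact_open_subgroupD(6)[OF K(1)] by (simp flip: m_assoc)
  ultimately show ?thesis using K(1) unfolding smooth_cpt_def rinv_cpt_def by blast
qed

text \<open>A level set of \<open>F\<close> is a left translate of a level set of the shifted function.\<close>

lemma lc_integral_translate:
  assumes F: "smooth_cpt F" and g: "g \<in> carrier G"
  shows "lc_integral M sc (\<lambda>x. F (g \<otimes> x)) = lc_integral M sc F"
proof -
  have onto: "(\<lambda>x. g \<otimes> x) ` {x \<in> carrier G. F (g \<otimes> x) \<in> U} = {x \<in> carrier G. F x \<in> U}" for U
  proof (intro equalityI subsetI)
    fix x assume x: "x \<in> {x \<in> carrier G. F x \<in> U}"
    hence "x = g \<otimes> (inv g \<otimes> x)" "inv g \<otimes> x \<in> {x \<in> carrier G. F (g \<otimes> x) \<in> U}" using g by auto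
    thus "x \<in> (\<lambda>x. g \<otimes> x) ` {x \<in> carrier G. F (g \<otimes> x) \<in> U}" by blast
  qed (use g in auto)
  have "(\<lambda>x. g \<otimes> x) ` carrier G = carrier G" using onto[of UNIV] by simp
  hence image: "(\<lambda>x. F (g \<otimes> x)) ` carrier G = F ` carrier G"
    by (metis image_image)
  have "emeasure M {x \<in> carrier G. F (g \<otimes> x) = v} = emeasure M {x \<in> carrier G. F x = v}" for v
    using haar_translate[OF g open_in_sets[OF open_level_set[OF smooth_cpt_translate[OF F g], of "{v}"]]]
      onto[of "{v}"] by simp
  thus ?thesis unfolding lc_integral_def measure_def space_haar image by simp
qed

lemma vector_space_complex: "vector_space ((*) :: complex \<Rightarrow> complex \<Rightarrow> complex)"
  by unfold_locales (simp_all add: algebra_simps)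

text \<open>The same finite sum computes the Bochner integral, so the convolutions, which are Bochner
  integrals, and the actions, which are algebraic integrals, can be compared.\<close>

lemma Bochner_integral_adapted:
  fixes F :: "'g \<Rightarrow> complex"
  assumes F: "adapted K S F"
  shows "(LINT g|M. F g) = (\<Sum>s\<in>S. complex_of_real (measure M K) * F s)"
proof -
  have K: "compact_open_subgroup G K" and S: "coset_reps K S" "finite S" "S \<subseteq> carrier G"
    using F by (auto simp: adapted_def coset_reps_def)
  have ind: "integrable M (indicat_real (lcos s K))" if "s \<in> S" for s
    using fmeasurable_l_coset[OF K, of s] S(3) that
    by (intro integrable_real_indicator) (auto simp: fmeasurable_def)
  have integral_ind: "(LINT g|M. indicat_real (lcos s K) g) = measure M K" if "s \<in> S" for s
  proof -
    have s: "s \<in> carrier G" using S(3) that by blast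
    have "lcos s K \<inter> space M = lcos s K" using l_coset_in_carrier[OF K s] by auto
    thus ?thesis using measure_l_coset[OF K s] by simp
  qed
  have "F g = (\<Sum>s\<in>S. indicat_real (lcos s K) g *\<^sub>R F s)" if g: "g \<in> carrier G" for g
  proof (cases "g \<in> (\<Union>s\<in>S. lcos s K)")
    case True
    then obtain s where s: "s \<in> S" "g \<in> lcos s K" by blast
    have "(\<Sum>t\<in>S. indicat_real (lcos t K) g *\<^sub>R F t) = (\<Sum>t\<in>{s}. indicat_real (lcos t K) g *\<^sub>R F t)"
      using s S(2) coset_reps_disjoint[OF K S(1) s(1)]
      by (intro sum.mono_neutral_right) (auto simp: indicator_def)
    thus ?thesis using s adapted_coset[OF F s] by simp
  next
    case False
    hence "F g = 0" using F g by (auto simp: adapted_def)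
    moreover have "(\<Sum>t\<in>S. indicat_real (lcos t K) g *\<^sub>R F t) = 0"
      using False by (intro sum.neutral) (auto simp: indicator_def)
    ultimately show ?thesis by simp
  qed
  hence "(LINT g|M. F g) = (LINT g|M. (\<Sum>s\<in>S. indicat_real (lcos s K) g *\<^sub>R F s))"
    by (intro Bochner_Integration.integral_cong) auto
  also have "\<dots> = (\<Sum>s\<in>S. (LINT g|M. indicat_real (lcos s K) g *\<^sub>R F s))"
    using ind by (intro Bochner_Integration.integral_sum integrable_scaleR_left)
  also have "\<dots> = (\<Sum>s\<in>S. measure M K *\<^sub>R F s)"
    using ind by (intro sum.cong[OF refl]) (simp only: integral_scaleR_left integral_ind)
  finally show ?thesis by (simp add: scaleR_conv_of_real)
qed

lemma Bochner_eq_lc_integral: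
  assumes "smooth_cpt F"
  shows "(LINT g|M. F g) = lc_integral M (*) F"
proof -
  obtain K S where KS: "adapted K S F" using smooth_cpt_common[OF assms assms] by blast
  show ?thesis
    unfolding Bochner_integral_adapted[OF KS] lc_integral_adapted[OF vector_space_complex KS] ..
qed

definition left_inv :: "'g set \<Rightarrow> ('g \<Rightarrow> 'v) \<Rightarrow> bool" where
  "left_inv K f \<longleftrightarrow> (\<forall>k\<in>K. \<forall>x\<in>carrier G. f (k \<otimes> x) = f x)"

lemma
  assumes K: "compact_open_subgroup G K" and f: "f \<in> hecke G K"
  shows hecke_rinv_cpt: "rinv_cpt K f" and hecke_left_inv: "left_inv K f"
    and hecke_outside: "x \<notin> carrier G \<Longrightarrow> f x = 0"
proof -
  obtain C where C: "compactin (grp_top G) C" "\<forall>x. x \<notin> C \<longrightarrow> f x = 0"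
    using f unfolding hecke_def by blast
  have bi: "f (k \<otimes> x \<otimes> l) = f x" if "k \<in> K" "x \<in> carrier G" "l \<in> K" for k x l
    using f that unfolding hecke_def by simp
  show "rinv_cpt K f"
    using C bi[OF compact_open_subgroupD(4)[OF K]] unfolding rinv_cpt_def
    by (intro conjI exI[of _ C]) simp_all
  show "left_inv K f"
    using bi[OF _ _ compact_open_subgroupD(4)[OF K]] compact_open_subgroupD(6)[OF K]
    unfolding left_inv_def by simp
  have "C \<subseteq> carrier G" using C(1) by (simp add: compactin_def)
  thus "x \<notin> carrier G \<Longrightarrow> f x = 0" using C(2) by blast
qed

lemma heckeI:
  fixes f :: "'g \<Rightarrow> complex"
  assumes K: "compact_open_subgroup G K" and f: "rinv_cpt K f" "left_inv K f"
    and out: "\<And>x. x \<notin> carrier G \<Longrightarrow> f x = 0"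
  shows "f \<in> hecke G K"
proof -
  have sm: "smooth_cpt f" unfolding smooth_cpt_def using K f(1) by (intro exI conjI)
  obtain C where C: "compactin (grp_top G) C" "\<forall>x\<in>carrier G - C. f x = 0"
    using f(1) unfolding rinv_cpt_def by blast
  have "continuous_map (grp_top G) euclidean f"
    unfolding continuous_map_def using open_level_set[OF sm] by simp
  moreover have "\<exists>C. compactin (grp_top G) C \<and> (\<forall>x. x \<notin> C \<longrightarrow> f x = 0)"
    using C out by (intro exI[of _ C]) auto
  moreover have "\<forall>k\<in>K. \<forall>x\<in>carrier G. \<forall>k'\<in>K. f (k \<otimes> x \<otimes> k') = f x"
    using f compact_open_subgroupD(6)[OF K] by (simp add: rinv_cpt_def left_inv_def)
  ultimately show ?thesis unfolding hecke_def by blast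
qed

lemma smooth_cptI: "compact_open_subgroup G K \<Longrightarrow> rinv_cpt K f \<Longrightarrow> smooth_cpt f"
  unfolding smooth_cpt_def by (intro exI conjI)

lemma hecke_smooth_cpt:
  "compact_open_subgroup G K \<Longrightarrow> f \<in> hecke G K \<Longrightarrow> smooth_cpt f"
  by (intro smooth_cptI[of K] hecke_rinv_cpt)

lemma adapted_self:
  "adapted K S F \<Longrightarrow> compact_open_subgroup G K" "adapted K S F \<Longrightarrow> finite S"
  "adapted K S F \<Longrightarrow> s \<in> S \<Longrightarrow> s \<in> carrier G"
  by (auto simp: adapted_def coset_reps_def)

section \<open>Convolution\<close>

lemma adapted_conv_integrand:
  fixes f f' :: "'g \<Rightarrow> complex"
  assumes f: "adapted L S f" and f': "left_inv L f'" and x: "x \<in> carrier G"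
  shows "adapted L S (\<lambda>g. f g * f' (inv g \<otimes> x))"
proof -
  have L: "compact_open_subgroup G L" using f by (rule adapted_self)
  have "f (g \<otimes> k) * f' (inv (g \<otimes> k) \<otimes> x) = f g * f' (inv g \<otimes> x)"
    if "g \<in> carrier G" "k \<in> L" for g k
  proof -
    have k: "k \<in> carrier G" "inv k \<in> L" using compact_open_subgroupD[OF L] that by auto
    have "f' (inv (g \<otimes> k) \<otimes> x) = f' (inv k \<otimes> (inv g \<otimes> x))"
      using that k x by (simp add: inv_mult_group m_assoc)
    also have "\<dots> = f' (inv g \<otimes> x)" using f' k x that by (simp add: left_inv_def)
    finally show ?thesis using f that by (simp add: adapted_def)
  qed
  thus ?thesis using f by (simp add: adapted_def)
qed

text \<open>Left invariance of \<open>f'\<close> under \<open>L\<close> lets one set of representatives serve for every \<open>x\<close>: the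
  convolution is a finite combination of left translates of \<open>f'\<close>.\<close>

lemma conv_adapted:
  assumes "adapted L S f" "left_inv L f'" "x \<in> carrier G"
  shows "hecke_conv G M f f' x = (\<Sum>s\<in>S. complex_of_real (measure M L) * (f s * f' (inv s \<otimes> x)))"
  using Bochner_integral_adapted[OF adapted_conv_integrand[OF assms]] assms(3)
  by (simp add: hecke_conv_def)

lemma smooth_cpt_scaled: "smooth_cpt f \<Longrightarrow> smooth_cpt (\<lambda>x. (c::complex) * f x)"
  using smooth_cpt_scale[OF _ vector_space_complex] .

lemma smooth_cpt_conv_summand:
  fixes f' :: "'g \<Rightarrow> complex"
  assumes "smooth_cpt f'" "s \<in> carrier G"
  shows "smooth_cpt (\<lambda>x. a * (b * f' (inv s \<otimes> x)))"
  using assms by (intro smooth_cpt_scaled[of "\<lambda>x. b * f' (inv s \<otimes> x)"]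
      smooth_cpt_scaled[of "\<lambda>x. f' (inv s \<otimes> x)"] smooth_cpt_translate) simp_all

lemma smooth_cpt_conv:
  assumes f: "adapted L S f" and f': "left_inv L f'" "smooth_cpt f'"
  shows "smooth_cpt (hecke_conv G M f f')"
proof -
  have "smooth_cpt (\<lambda>x. \<Sum>s\<in>S. complex_of_real (measure M L) * (f s * f' (inv s \<otimes> x)))"
    using smooth_cpt_conv_summand[OF f'(2) adapted_self(3)[OF f]]
    by (rule smooth_cpt_sum[OF adapted_self(2)[OF f]])
  thus ?thesis
    using smooth_cpt_cong[of "hecke_conv G M f f'", OF conv_adapted[OF f f'(1)]] by simp
qed

lemma left_inv_conv:
  fixes f f' :: "'g \<Rightarrow> complex"
  assumes K: "compact_open_subgroup G K" "left_inv K f" and f: "adapted L S f" "left_inv L f'"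
  shows "left_inv K (hecke_conv G M f f')"
  unfolding left_inv_def
proof (intro ballI)
  fix k x assume kx: "k \<in> K" "x \<in> carrier G"
  have k: "k \<in> carrier G" using compact_open_subgroupD(6)[OF K(1) kx(1)] .
  let ?F = "\<lambda>g. f g * f' (inv g \<otimes> (k \<otimes> x))"
  have F: "smooth_cpt ?F" 
    using adapted_smooth_cpt(2)[OF adapted_conv_integrand[OF f]] k kx by simp
  have "(LINT g|M. ?F g) = lc_integral M (*) (\<lambda>g. ?F (k \<otimes> g))"
    using Bochner_eq_lc_integral[OF F] lc_integral_translate[OF F k] by simp
  also have "\<dots> = (LINT g|M. ?F (k \<otimes> g))"
    using Bochner_eq_lc_integral[OF smooth_cpt_translate[OF F k]] by simp
  also have "\<dots> = (LINT g|M. f g * f' (inv g \<otimes> x))"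
    using k kx K(2) by (intro Bochner_Integration.integral_cong)
      (auto simp: left_inv_def inv_mult_group m_assoc)
  finally show "hecke_conv G M f f' (k \<otimes> x) = hecke_conv G M f f' x"
    using k kx by (simp add: hecke_conv_def)
qed

lemma right_inv_conv:
  assumes K: "compact_open_subgroup G K" "rinv_cpt K f'" and x: "x \<in> carrier G" "k \<in> K"
  shows "hecke_conv G M f f' (x \<otimes> k) = hecke_conv G M f f' x"
proof -
  have k: "k \<in> carrier G" using compact_open_subgroupD(6)[OF K(1) x(2)] .
  have "(LINT g|M. f g * f' (inv g \<otimes> (x \<otimes> k))) = (LINT g|M. f g * f' (inv g \<otimes> x))"
    using k x K(2) by (intro Bochner_Integration.integral_cong)
      (auto simp: rinv_cpt_def simp flip: m_assoc)
  thus ?thesis using k x by (simp add: hecke_conv_def)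
qed

lemma smooth_cpt_rinv_cpt:
  assumes "smooth_cpt F" "\<And>x k. x \<in> carrier G \<Longrightarrow> k \<in> K \<Longrightarrow> F (x \<otimes> k) = F x"
  shows "rinv_cpt K F"
  using assms unfolding smooth_cpt_def rinv_cpt_def by blast

lemma hecke_conv_closed:
  fixes f f' :: "'g \<Rightarrow> complex"
  assumes K: "compact_open_subgroup G K" and f: "left_inv K f" "adapted L S f"
    and f': "left_inv L f'" "rinv_cpt K f'"
  shows "hecke_conv G M f f' \<in> hecke G K"
proof (rule heckeI[OF K])
  show "rinv_cpt K (hecke_conv G M f f')"
    using smooth_cpt_conv[OF f(2) f'(1) smooth_cptI[OF K f'(2)]] right_inv_conv[OF K f'(2)]
    by (rule smooth_cpt_rinv_cpt)
  show "left_inv K (hecke_conv G M f f')" using left_inv_conv[OF K f f'(1)] .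
qed (simp add: hecke_conv_def)

text \<open>The action is defined on all vectors, not only on those fixed by \<open>K\<close>: with the unit of the
  Hecke algebra it becomes the projection onto the fixed vectors.\<close>

definition hecke_act ::
  "(complex \<Rightarrow> 'v \<Rightarrow> 'v) \<Rightarrow> ('g \<Rightarrow> 'v \<Rightarrow> 'v) \<Rightarrow> ('g \<Rightarrow> complex) \<Rightarrow> 'v \<Rightarrow> 'v::ab_group_add" where
  "hecke_act sc \<pi> f v = lc_integral M sc (\<lambda>g. sc (f g) (\<pi> g v))"

lemma unit_rinv_cpt:
  assumes K: "compact_open_subgroup G K"
  shows "rinv_cpt K (hecke_unit M K)" "left_inv K (hecke_unit M K)" "adapted K {\<one>} (hecke_unit M K)"
proof -
  note KD = compact_open_subgroupD[OF K]
  interpret K: subgroup K G by (rule KD)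
  have r: "x \<otimes> k \<in> K \<longleftrightarrow> x \<in> K" "k \<otimes> x \<in> K \<longleftrightarrow> x \<in> K" if "k \<in> K" "x \<in> carrier G" for k x
  proof -
    have "x = (x \<otimes> k) \<otimes> inv k" "x = inv k \<otimes> (k \<otimes> x)"
      using that KD(6) by (simp_all add: m_assoc)
    thus "x \<otimes> k \<in> K \<longleftrightarrow> x \<in> K" "k \<otimes> x \<in> K \<longleftrightarrow> x \<in> K"
      using that KD(7,8) by metis+
  qed
  have "lcos \<one> K = K" using lcos_mult_one[OF KD(5)] .
  thus "adapted K {\<one>} (hecke_unit M K)"
    using K r by (auto simp: adapted_def coset_reps_def hecke_unit_def)
  thus "rinv_cpt K (hecke_unit M K)" by (rule adapted_smooth_cpt)
  show "left_inv K (hecke_unit M K)" using r by (auto simp: left_inv_def hecke_unit_def)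
qed

end

section \<open>The action of functions on a smooth representation\<close>

locale haar_rep = haar_group G M for G :: "'g top_group" (structure) and M +
  fixes sc :: "complex \<Rightarrow> 'v \<Rightarrow> 'v::ab_group_add" and \<pi> :: "'g \<Rightarrow> 'v \<Rightarrow> 'v"
  assumes smooth_rep: "smooth_rep G sc \<pi>"
begin

sublocale vector_space sc
  using smooth_rep by (simp add: smooth_rep_def)

lemma
  shows rep_linear: "g \<in> carrier G \<Longrightarrow> Vector_Spaces.linear sc sc (\<pi> g)"
    and rep_one: "\<pi> \<one> v = v"
    and rep_mult: "g \<in> carrier G \<Longrightarrow> h \<in> carrier G \<Longrightarrow> \<pi> (g \<otimes> h) v = \<pi> g (\<pi> h v)"
    and stabilizer_open: "openin (grp_top G) {g \<in> carrier G. \<pi> g v = v}"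
  using smooth_rep by (simp_all add: smooth_rep_def)

abbreviation act :: "('g \<Rightarrow> complex) \<Rightarrow> 'v \<Rightarrow> 'v" where
  "act \<equiv> hecke_act sc \<pi>"

definition fixed :: "'g set \<Rightarrow> 'v set" where
  "fixed K = {v. \<forall>k\<in>K. \<pi> k v = v}"

lemma rep_simps:
  assumes "g \<in> carrier G"
  shows "\<pi> g (v + w) = \<pi> g v + \<pi> g w" "\<pi> g (sc c v) = sc c (\<pi> g v)" "\<pi> g 0 = 0"
    "\<pi> g (sum F I) = (\<Sum>i\<in>I. \<pi> g (F i))"
proof -
  interpret A: Vector_Spaces.linear sc sc "\<pi> g" using rep_linear[OF assms] .
  show "\<pi> g (v + w) = \<pi> g v + \<pi> g w" "\<pi> g (sc c v) = sc c (\<pi> g v)" "\<pi> g 0 = 0"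
    "\<pi> g (sum F I) = (\<Sum>i\<in>I. \<pi> g (F i))"
    by (simp_all add: A.add A.scale A.sum A.zero)
qed

lemma subspace_fixed: "K \<subseteq> carrier G \<Longrightarrow> subspace (fixed K)"
  unfolding subspace_def fixed_def by (auto simp: rep_simps subset_iff)

lemma adapted_act:
  assumes "adapted K S f" "v \<in> fixed K"
  shows "adapted K S (\<lambda>g. sc (f g) (\<pi> g v))"
  using assms compact_open_subgroupD(6)[OF adapted_self(1)[OF assms(1)]]
  by (auto simp: adapted_def fixed_def rep_mult)

lemma act_adapted:
  assumes "adapted K S f" "v \<in> fixed K"
  shows "act f v = (\<Sum>s\<in>S. sc (complex_of_real (measure M K)) (sc (f s) (\<pi> s v)))"
  unfolding hecke_act_def
  using lc_integral_adapted[OF vector_space_axioms adapted_act[OF assms]] .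

lemma fixed_by_compact_open:
  assumes "compact_open_subgroup G K"
  obtains L where "compact_open_subgroup G L" "L \<subseteq> K" "v \<in> fixed L"
proof -
  have "\<one> \<in> {g \<in> carrier G. \<pi> g v = v}" by (simp add: rep_one)
  then obtain L where L: "compact_open_subgroup G L" "L \<subseteq> K" "L \<subseteq> {g \<in> carrier G. \<pi> g v = v}"
    by (rule compact_open_subgroup_Int_below[OF assms stabilizer_open[of v]])
  from L(3) have "v \<in> fixed L" unfolding fixed_def by blast
  from that[OF L(1,2) this] show thesis .
qed

lemma smooth_cpt_act:
  assumes "smooth_cpt f"
  shows "smooth_cpt (\<lambda>g. sc (f g) (\<pi> g v))"
proof -
  obtain K where K: "compact_open_subgroup G K" "rinv_cpt K f"
    using assms unfolding smooth_cpt_def by (elim exE conjE)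
  obtain L where L: "compact_open_subgroup G L" "L \<subseteq> K" "v \<in> fixed L"
    using fixed_by_compact_open[OF K(1)] .
  have "rinv_cpt L f" using rinv_cpt_mono[OF K(2) L(2)] .
  then obtain S where "adapted L S f" using rinv_cpt_adapted[OF L(1)] by blast
  thus ?thesis using adapted_act[OF _ L(3)] adapted_smooth_cpt(2) by blast
qed

lemma act_cong: "(\<And>x. x \<in> carrier G \<Longrightarrow> f x = f' x) \<Longrightarrow> act f v = act f' v"
  unfolding hecke_act_def by (rule lc_integral_cong) simp

lemma act_add_left:
  assumes "smooth_cpt f" "smooth_cpt f'"
  shows "act (\<lambda>x. f x + f' x) v = act f v + act f' v"
  using lc_integral_add[OF smooth_cpt_act[OF assms(1)] smooth_cpt_act[OF assms(2)] vector_space_axioms]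
  by (simp add: hecke_act_def scale_left_distrib)

lemma act_scale_left:
  assumes "smooth_cpt f"
  shows "act (\<lambda>x. c * f x) v = sc c (act f v)"
  using lc_integral_scale[OF smooth_cpt_act[OF assms] vector_space_axioms]
  by (simp add: hecke_act_def)

lemma act_sum_left:
  assumes "finite I" "\<And>i. i \<in> I \<Longrightarrow> smooth_cpt (f i)"
  shows "act (\<lambda>x. \<Sum>i\<in>I. f i x) v = (\<Sum>i\<in>I. act (f i) v)"
  using lc_integral_sum[OF assms(1) smooth_cpt_act[OF assms(2)] vector_space_axioms]
  by (simp add: hecke_act_def scale_sum_left)

lemma act_linear:
  assumes f: "smooth_cpt f"
  shows "Vector_Spaces.linear sc sc (act f)"
proof (subst Vector_Spaces.linear_iff, intro conjI allI)
  show "act f (v + w) = act f v + act f w" for v w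
  proof -
    have "act f (v + w) = lc_integral M sc (\<lambda>g. sc (f g) (\<pi> g v) + sc (f g) (\<pi> g w))"
      unfolding hecke_act_def by (rule lc_integral_cong) (simp add: rep_simps scale_right_distrib)
    also have "\<dots> = act f v + act f w"
      unfolding hecke_act_def
      by (rule lc_integral_add[OF smooth_cpt_act[OF f] smooth_cpt_act[OF f] vector_space_axioms])
    finally show ?thesis .
  qed
  show "act f (sc c v) = sc c (act f v)" for c v
  proof -
    have "act f (sc c v) = lc_integral M sc (\<lambda>g. sc c (sc (f g) (\<pi> g v)))"
      unfolding hecke_act_def
      by (rule lc_integral_cong) (simp add: rep_simps scale_left_commute)
    also have "\<dots> = sc c (act f v)"
      unfolding hecke_act_def by (rule lc_integral_scale[OF smooth_cpt_act[OF f] vector_space_axioms])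
    finally show ?thesis .
  qed
qed (rule vector_space_axioms)+

lemma act_translate:
  assumes f: "smooth_cpt f" and s: "s \<in> carrier G"
  shows "act (\<lambda>x. f (inv s \<otimes> x)) v = \<pi> s (act f v)"
proof -
  let ?F = "\<lambda>x. sc (f (inv s \<otimes> x)) (\<pi> x v)"
  have "smooth_cpt ?F" using smooth_cpt_act[OF smooth_cpt_translate[OF f]] s by simp
  hence "act (\<lambda>x. f (inv s \<otimes> x)) v = lc_integral M sc (\<lambda>x. ?F (s \<otimes> x))"
    unfolding hecke_act_def using lc_integral_translate[OF _ s, of ?F] by simp
  also have "\<dots> = lc_integral M sc (\<lambda>x. \<pi> s (sc (f x) (\<pi> x v)))"
    using s by (intro lc_integral_cong) (simp add: rep_mult rep_simps)
  also have "\<dots> = \<pi> s (act f v)"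
    unfolding hecke_act_def by (rule lc_integral_linear[OF smooth_cpt_act[OF f] rep_linear[OF s]])
  finally show ?thesis .
qed

lemma act_fixed:
  assumes K: "compact_open_subgroup G K" and f: "smooth_cpt f" "left_inv K f"
  shows "act f v \<in> fixed K"
proof -
  have "\<pi> k (act f v) = act f v" if k: "k \<in> K" for k
  proof -
    note kG = compact_open_subgroupD(6)[OF K k]
    have "\<pi> k (act f v) = act (\<lambda>x. f (inv k \<otimes> x)) v" using act_translate[OF f(1) kG] by simp
    also have "\<dots> = act f v"
      using f(2) compact_open_subgroupD(7)[OF K k] by (intro act_cong) (simp add: left_inv_def)
    finally show ?thesis .
  qed
  thus ?thesis by (simp add: fixed_def)
qed

text \<open>Both sides are \<open>\<Sum>s. \<mu>(L) f(s) \<pi>(s) (f' v)\<close>. On the left this comes from writing \<open>f * f'\<close>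
  as a combination of translates of \<open>f'\<close>, on the right from the fact that \<open>f' v\<close> is fixed
  by \<open>L\<close>.\<close>

lemma act_conv:
  assumes f: "adapted L S f" and f': "left_inv L f'" "smooth_cpt f'"
  shows "act (hecke_conv G M f f') v = act f (act f' v)"
proof -
  note S = adapted_self[OF f]
  let ?m = "complex_of_real (measure M L)"
  have "act (hecke_conv G M f f') v = act (\<lambda>x. \<Sum>s\<in>S. ?m * (f s * f' (inv s \<otimes> x))) v"
    by (rule act_cong) (rule conv_adapted[OF f f'(1)])
  also have "\<dots> = (\<Sum>s\<in>S. act (\<lambda>x. ?m * (f s * f' (inv s \<otimes> x))) v)"
    using smooth_cpt_conv_summand[OF f'(2) S(3)] by (rule act_sum_left[OF S(2)])
  also have "\<dots> = (\<Sum>s\<in>S. sc ?m (sc (f s) (\<pi> s (act f' v))))"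
  proof (rule sum.cong[OF refl])
    fix s assume s: "s \<in> S"
    have sm: "smooth_cpt (\<lambda>x. f' (inv s \<otimes> x))" using smooth_cpt_translate[OF f'(2)] S(3)[OF s] by simp
    show "act (\<lambda>x. ?m * (f s * f' (inv s \<otimes> x))) v = sc ?m (sc (f s) (\<pi> s (act f' v)))"
      unfolding act_scale_left[OF smooth_cpt_scaled[OF sm]] act_scale_left[OF sm]
        act_translate[OF f'(2) S(3)[OF s]] ..
  qed
  also have "\<dots> = act f (act f' v)"
    using act_adapted[OF f act_fixed[OF S(1) f'(2,1)]] by simp
  finally show ?thesis .
qed

lemma act_unit:
  assumes K: "compact_open_subgroup G K" and v: "v \<in> fixed K"
  shows "act (hecke_unit M K) v = v"
  using act_adapted[OF unit_rinv_cpt(3)[OF K] v] mu_nonzero[OF K] compact_open_subgroupD(4)[OF K]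
  by (simp add: hecke_unit_def rep_one)

text \<open>For \<open>w\<close> fixed by \<open>K\<close> the vector \<open>\<pi> g w\<close> is \<open>c w\<close>, where \<open>c\<close> is the normalized indicator of the
  coset \<open>g K\<close>. Hence projecting it to the fixed vectors amounts to acting by the convolution
  of the unit with \<open>c\<close>, which is invariant under \<open>K\<close> on both sides. The associativity of the action
  applies because \<open>c\<close> is left invariant under a small subgroup of the conjugate of \<open>K\<close> by \<open>g\<close>.\<close>

lemma project_translate:
  assumes K: "compact_open_subgroup G K" and g: "g \<in> carrier G" and w: "w \<in> fixed K"
  shows "\<exists>f\<in>hecke G K. act (hecke_unit M K) (\<pi> g w) = act f w"
proof -
  note KD = compact_open_subgroupD[OF K]
  define c :: "'g \<Rightarrow> complex" where "c x = hecke_unit M K (inv g \<otimes> x)" for x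
  have gK: "inv g \<otimes> x \<in> K \<longleftrightarrow> x \<in> lcos g K" if "x \<in> carrier G" for x
  proof
    assume "inv g \<otimes> x \<in> K"
    moreover have "x = g \<otimes> (inv g \<otimes> x)" using g that by simp
    ultimately show "x \<in> lcos g K" unfolding l_coset_image by blast
  qed (use g KD in \<open>auto simp: l_coset_def\<close>)
  have c_rinv: "rinv_cpt K c"
  proof (rule smooth_cpt_rinv_cpt)
    show "smooth_cpt c" unfolding c_def
      using smooth_cpt_translate[OF smooth_cptI[OF K unit_rinv_cpt(1)[OF K]]] g by simp
    show "c (x \<otimes> k) = c x" if "x \<in> carrier G" "k \<in> K" for x k
      using unit_rinv_cpt(1)[OF K] that g KD(6)[OF that(2)]
      by (simp add: c_def rinv_cpt_def flip: m_assoc)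
  qed
  hence c_smooth: "smooth_cpt c" by (rule smooth_cptI[OF K])
  have act_c: "act c w = \<pi> g w"
    using act_translate[OF smooth_cptI[OF K unit_rinv_cpt(1)[OF K]] g, of w] act_unit[OF K w]
    by (simp add: c_def[abs_def])
  \<comment> \<open>\<open>L \<subseteq> K\<close> keeps the unit right invariant under \<open>L\<close>, the conjugate makes \<open>c\<close> left invariant\<close>
  obtain L where L: "compact_open_subgroup G L" "L \<subseteq> K" "L \<subseteq> (\<lambda>x. g \<otimes> x \<otimes> inv g) ` K"
    using compact_open_subgroup_Int_below[OF K conjugate_compact_open[OF K g]] .
  have c_left: "left_inv L c"
    unfolding left_inv_def
  proof (intro ballI)
    fix l x assume l: "l \<in> L" and x: "x \<in> carrier G"
    then obtain k where k: "k \<in> K" "l = g \<otimes> k \<otimes> inv g" using L(3) by blast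
    have "inv g \<otimes> (l \<otimes> x) = k \<otimes> (inv g \<otimes> x)" using k KD(6) g x by (simp add: m_assoc)
    thus "c (l \<otimes> x) = c x"
      using unit_rinv_cpt(2)[OF K] k(1) g x by (simp add: c_def left_inv_def)
  qed
  obtain S where S: "adapted L S (hecke_unit M K)"
    using rinv_cpt_adapted[OF L(1) rinv_cpt_mono[OF unit_rinv_cpt(1)[OF K] L(2)]] .
  show ?thesis
  proof
    show "hecke_conv G M (hecke_unit M K) c \<in> hecke G K"
      using hecke_conv_closed[OF K unit_rinv_cpt(2)[OF K] S c_left c_rinv] .
    show "act (hecke_unit M K) (\<pi> g w) = act (hecke_conv G M (hecke_unit M K) c) w"
      using act_conv[OF S c_left c_smooth] act_c by simp
  qed
qed

text \<open>A fixed vector equals its own projection, and the projection maps every generator of the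
  span into \<open>W\<close>.\<close>

lemma hecke_span_fixed:
  assumes K: "compact_open_subgroup G K" and W: "subspace W" "W \<subseteq> fixed K"
    and stable: "\<And>f w. f \<in> hecke G K \<Longrightarrow> w \<in> W \<Longrightarrow> act f w \<in> W"
  shows "span {\<pi> g w | g w. g \<in> carrier G \<and> w \<in> W} \<inter> fixed K = W"
proof (intro equalityI subsetI)
  fix w assume w: "w \<in> W"
  hence "w \<in> {\<pi> g w | g w. g \<in> carrier G \<and> w \<in> W}"
    by (intro CollectI exI[of _ \<one>] exI[of _ w]) (simp add: rep_one)
  from IntI[OF span_base[OF this] subsetD[OF W(2) w]]
  show "w \<in> span {\<pi> g w | g w. g \<in> carrier G \<and> w \<in> W} \<inter> fixed K" .
next
  fix v assume v: "v \<in> span {\<pi> g w | g w. g \<in> carrier G \<and> w \<in> W} \<inter> fixed K"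
  interpret e: Vector_Spaces.linear sc sc "act (hecke_unit M K)"
    using act_linear[OF smooth_cptI[OF K unit_rinv_cpt(1)[OF K]]] .
  have "act (hecke_unit M K) u \<in> W"
    if "u \<in> {\<pi> g w | g w. g \<in> carrier G \<and> w \<in> W}" for u
  proof -
    obtain g w where gw: "g \<in> carrier G" "w \<in> W" "u = \<pi> g w" using \<open>u \<in> _\<close> by blast
    obtain f where "f \<in> hecke G K" "act (hecke_unit M K) u = act f w"
      using project_translate[OF K gw(1) subsetD[OF W(2) gw(2)]] gw(3) by auto
    thus ?thesis using stable gw(2) by simp
  qed
  hence "{\<pi> g w | g w. g \<in> carrier G \<and> w \<in> W} \<subseteq> act (hecke_unit M K) -` W" by blast
  hence "span {\<pi> g w | g w. g \<in> carrier G \<and> w \<in> W} \<subseteq> act (hecke_unit M K) -` W"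
    using e.subspace_vimage[OF W(1)] by (rule span_minimal)
  thus "v \<in> W" using v act_unit[OF K, of v] by auto
qed

end

section \<open>Twisted spaces\<close>

locale twisted_group = haar_group G M for G :: "'g top_group" (structure) and M +
  fixes X :: "('g, 'x) twisted"
  assumes twisted: "twisted_space G X"
begin

abbreviation lact :: "'g \<Rightarrow> 'x \<Rightarrow> 'x" where "lact \<equiv> tw_act X"
abbreviation ract :: "'x \<Rightarrow> 'g \<Rightarrow> 'x" where "ract \<equiv> tw_ract X"
abbreviation \<theta> :: "'x \<Rightarrow> 'g \<Rightarrow> 'g" where "\<theta> \<equiv> tw_int X"

lemma
  shows lact_one: "\<delta> \<in> tw_points X \<Longrightarrow> lact \<one> \<delta> = \<delta>"
    and lact_mult: "g \<in> carrier G \<Longrightarrow> h \<in> carrier G \<Longrightarrow> \<delta> \<in> tw_points X \<Longrightarrow>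
      lact (g \<otimes> h) \<delta> = lact g (lact h \<delta>)"
    and homeomorphic_lact: "\<delta> \<in> tw_points X \<Longrightarrow>
      homeomorphic_map (grp_top G) (tw_top X) (\<lambda>g. lact g \<delta>)"
    and int_iso: "\<delta> \<in> tw_points X \<Longrightarrow> \<theta> \<delta> \<in> iso G G"
    and homeomorphic_int: "\<delta> \<in> tw_points X \<Longrightarrow>
      homeomorphic_map (grp_top G) (grp_top G) (\<theta> \<delta>)"
    and int_lact: "g \<in> carrier G \<Longrightarrow> \<delta> \<in> tw_points X \<Longrightarrow> x \<in> carrier G \<Longrightarrow>
      \<theta> (lact g \<delta>) x = g \<otimes> \<theta> \<delta> x \<otimes> inv g"
  using twisted unfolding twisted_space_def by blast+

lemma
  assumes d: "\<delta> \<in> tw_points X"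
  shows int_closed: "g \<in> carrier G \<Longrightarrow> \<theta> \<delta> g \<in> carrier G"
    and int_mult: "g \<in> carrier G \<Longrightarrow> h \<in> carrier G \<Longrightarrow> \<theta> \<delta> (g \<otimes> h) = \<theta> \<delta> g \<otimes> \<theta> \<delta> h"
    and int_onto: "\<theta> \<delta> ` carrier G = carrier G"
    and int_one: "\<theta> \<delta> \<one> = \<one>"
proof -
  have hom: "\<theta> \<delta> \<in> hom G G" using int_iso[OF d] by (simp add: iso_def)
  show "g \<in> carrier G \<Longrightarrow> \<theta> \<delta> g \<in> carrier G" using hom_in_carrier[OF hom] .
  show "g \<in> carrier G \<Longrightarrow> h \<in> carrier G \<Longrightarrow> \<theta> \<delta> (g \<otimes> h) = \<theta> \<delta> g \<otimes> \<theta> \<delta> h"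
    using hom_mult[OF hom] .
  show "\<theta> \<delta> ` carrier G = carrier G" using int_iso[OF d] by (simp add: iso_def bij_betw_def)
  show "\<theta> \<delta> \<one> = \<one>" using hom_one[OF hom is_group is_group] .
qed

lemma lact_closed: "g \<in> carrier G \<Longrightarrow> \<delta> \<in> tw_points X \<Longrightarrow> lact g \<delta> \<in> tw_points X"
  using homeomorphic_imp_surjective_map[OF homeomorphic_lact] by auto

lemma ract_closed: "g \<in> carrier G \<Longrightarrow> \<delta> \<in> tw_points X \<Longrightarrow> ract \<delta> g \<in> tw_points X"
  unfolding tw_ract_def by (intro lact_closed int_closed)

lemma ract_lact:
  assumes "x \<in> carrier G" "g \<in> carrier G" "\<delta> \<in> tw_points X"
  shows "ract (lact x \<delta>) g = lact x (ract \<delta> g)"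
  unfolding tw_ract_def using assms int_closed[OF assms(3,2)]
  by (simp add: int_lact m_assoc lact_closed flip: lact_mult)

lemma ract_mult:
  assumes "g \<in> carrier G" "h \<in> carrier G" "\<delta> \<in> tw_points X"
  shows "ract \<delta> (g \<otimes> h) = ract (ract \<delta> g) h"
proof -
  have "ract (ract \<delta> g) h = lact (\<theta> \<delta> g) (ract \<delta> h)"
    unfolding tw_ract_def[of X \<delta> g] using ract_lact[OF int_closed] assms by simp
  also have "\<dots> = ract \<delta> (g \<otimes> h)"
    unfolding tw_ract_def using assms int_closed[OF assms(3)] by (simp add: int_mult lact_mult)
  finally show ?thesis ..
qed

lemma ract_one: "\<delta> \<in> tw_points X \<Longrightarrow> ract \<delta> \<one> = \<delta>"
  by (simp add: tw_ract_def int_one lact_one)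

lemma homeomorphic_ract:
  assumes "\<delta> \<in> tw_points X"
  shows "homeomorphic_map (grp_top G) (tw_top X) (\<lambda>g. ract \<delta> g)"
  using homeomorphic_map_compose[OF homeomorphic_int[OF assms] homeomorphic_lact[OF assms]]
  by (simp add: o_def tw_ract_def)

lemma ract_onto: "\<delta> \<in> tw_points X \<Longrightarrow> (\<lambda>g. ract \<delta> g) ` carrier G = tw_points X"
  using homeomorphic_imp_surjective_map[OF homeomorphic_ract] by simp

lemma lact_onto: "\<delta> \<in> tw_points X \<Longrightarrow> (\<lambda>g. lact g \<delta>) ` carrier G = tw_points X"
  using homeomorphic_imp_surjective_map[OF homeomorphic_lact] by simp

lemma ract_inj: "\<delta> \<in> tw_points X \<Longrightarrow> inj_on (\<lambda>g. ract \<delta> g) (carrier G)"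
  using homeomorphic_imp_injective_map[OF homeomorphic_ract] by simp

lemma ract_obtain:
  assumes "\<delta> \<in> tw_points X" "\<gamma> \<in> tw_points X"
  obtains g where "g \<in> carrier G" "\<gamma> = ract \<delta> g"
  using ract_onto[OF assms(1)] assms(2) by blast

lemma lact_obtain:
  assumes "\<delta> \<in> tw_points X" "\<gamma> \<in> tw_points X"
  obtains g where "g \<in> carrier G" "\<gamma> = lact g \<delta>"
  using lact_onto[OF assms(1)] assms(2) by blast

lemma space_borel_on: "space (borel_on T) = topspace T"
  by (simp add: borel_on_def space_measure_of_conv)

lemma open_in_borel_on: "openin T U \<Longrightarrow> U \<in> sets (borel_on T)"
  using openin_subset[of T] by (auto simp: borel_on_def sets_measure_of_conv)

lemma measurable_ract:
  assumes d: "\<delta> \<in> tw_points X"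
  shows "(\<lambda>g. ract \<delta> g) \<in> measurable M (borel_on (tw_top X))"
  unfolding borel_on_def
proof (rule measurable_measure_of)
  show "{U. openin (tw_top X) U} \<subseteq> Pow (tw_points X)" using openin_subset by auto
  show "(\<lambda>g. ract \<delta> g) \<in> space M \<rightarrow> tw_points X" using ract_closed[OF _ d] by simp
  fix U assume "U \<in> {U. openin (tw_top X) U}"
  hence "openin (grp_top G) {g \<in> topspace (grp_top G). ract \<delta> g \<in> U}"
    using openin_continuous_map_preimage[OF homeomorphic_imp_continuous_map[OF homeomorphic_ract[OF d]]]
    by blast
  moreover have "(\<lambda>g. ract \<delta> g) -` U \<inter> space M = {g \<in> topspace (grp_top G). ract \<delta> g \<in> U}" by auto
  ultimately show "(\<lambda>g. ract \<delta> g) -` U \<inter> space M \<in> sets M" using open_in_sets by simp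
qed

lemma smooth_cpt_base_change:
  assumes F: "smooth_cpt (\<lambda>g. F (ract \<delta> g))" and d: "\<delta> \<in> tw_points X" "a \<in> carrier G"
  shows "smooth_cpt (\<lambda>g. F (ract (ract \<delta> a) g))"
    "lc_integral M sc (\<lambda>g. F (ract (ract \<delta> a) g)) = lc_integral M sc (\<lambda>g. F (ract \<delta> g))"
proof -
  have eq: "F (ract (ract \<delta> a) g) = F (ract \<delta> (a \<otimes> g))" if "g \<in> carrier G" for g
    using ract_mult[OF d(2) that d(1)] by simp
  show "smooth_cpt (\<lambda>g. F (ract (ract \<delta> a) g))"
    using smooth_cpt_translate[OF F d(2)] smooth_cpt_cong[of "\<lambda>g. F (ract (ract \<delta> a) g)", OF eq] by simp
  show "lc_integral M sc (\<lambda>g. F (ract (ract \<delta> a) g)) = lc_integral M sc (\<lambda>g. F (ract \<delta> g))"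
    using lc_integral_translate[OF F d(2)]
      lc_integral_cong[of "\<lambda>g. F (ract (ract \<delta> a) g)", OF eq] by metis
qed

text \<open>Changing the base point of the twisted space is a left translation on \<open>G\<close>, hence the
  integral over the twisted space may be computed from any base point.\<close>

lemma lc_integral_tw_measure:
  assumes F: "smooth_cpt (\<lambda>g. F (ract \<delta> g))" and d: "\<delta> \<in> tw_points X"
  shows "lc_integral (tw_measure X M) sc F = lc_integral M sc (\<lambda>g. F (ract \<delta> g))"
proof -
  define \<epsilon> where "\<epsilon> = (SOME \<delta>. \<delta> \<in> tw_points X)"
  have e: "\<epsilon> \<in> tw_points X" unfolding \<epsilon>_def using d by (rule someI)
  obtain a where a: "a \<in> carrier G" "\<epsilon> = ract \<delta> a" using ract_obtain[OF d e] .
  note Fe = smooth_cpt_base_change(1)[OF F d a(1), folded a(2)]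
  have N: "tw_measure X M = distr M (borel_on (tw_top X)) (\<lambda>g. ract \<epsilon> g)"
    unfolding tw_measure_def \<epsilon>_def ..
  have space: "space (tw_measure X M) = tw_points X" by (simp add: N space_borel_on)
  have image: "F ` tw_points X = (\<lambda>g. F (ract \<epsilon> g)) ` carrier G"
    unfolding ract_onto[OF e, symmetric] image_image ..
  have meas: "measure (tw_measure X M) {x \<in> tw_points X. F x = v}
      = measure M {g \<in> carrier G. F (ract \<epsilon> g) = v}" for v
  proof -
    let ?A = "{g \<in> carrier G. F (ract \<epsilon> g) = v}"
    have "{x \<in> tw_points X. F x = v} = (\<lambda>g. ract \<epsilon> g) ` ?A"
      using ract_onto[OF e] by auto
    moreover have "openin (tw_top X) ((\<lambda>g. ract \<epsilon> g) ` ?A)"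
      using homeomorphic_imp_open_map[OF homeomorphic_ract[OF e]]
        open_level_set[OF Fe, of "{v}"] by (simp add: open_map_def)
    ultimately have "{x \<in> tw_points X. F x = v} \<in> sets (borel_on (tw_top X))"
      using open_in_borel_on by simp
    hence "measure (tw_measure X M) {x \<in> tw_points X. F x = v}
        = measure M ((\<lambda>g. ract \<epsilon> g) -` {x \<in> tw_points X. F x = v} \<inter> space M)"
      unfolding N by (rule measure_distr[OF measurable_ract[OF e]])
    also have "(\<lambda>g. ract \<epsilon> g) -` {x \<in> tw_points X. F x = v} \<inter> space M = ?A"
      using ract_closed[OF _ e] by auto
    finally show ?thesis .
  qed
  have "lc_integral (tw_measure X M) sc F = lc_integral M sc (\<lambda>g. F (ract \<epsilon> g))"
    unfolding lc_integral_def space image space_haar meas ..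
  thus ?thesis unfolding a(2) smooth_cpt_base_change(2)[OF F d a(1)] .
qed

end

text \<open>The base point \<open>\<delta>\<close> normalizes \<open>K\<close>; this is what makes the twisted bimodule a copy of the Hecke
  algebra and makes \<open>\<Pi>(\<delta>)\<close> preserve the vectors fixed by \<open>K\<close>.\<close>

locale twisted_level = twisted_group G M X for G :: "'g top_group" (structure) and M
  and X :: "('g, 'x) twisted" +
  fixes \<omega> :: "'g \<Rightarrow> complex" and K :: "'g set" and \<delta> :: 'x
  assumes omega: "grp_character G \<omega>"
    and K: "compact_open_subgroup G K"
    and omega_K: "\<And>k. k \<in> K \<Longrightarrow> \<omega> k = 1"
    and base: "\<delta> \<in> tw_points X"
    and base_K: "\<theta> \<delta> ` K = K"
begin

lemmas KD = compact_open_subgroupD[OF K]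

lemma omega_mult: "x \<in> carrier G \<Longrightarrow> y \<in> carrier G \<Longrightarrow> \<omega> (x \<otimes> y) = \<omega> x * \<omega> y"
  using omega by (simp add: grp_character_def)

lemma omega_nonzero: "x \<in> carrier G \<Longrightarrow> \<omega> x \<noteq> 0"
  using omega unfolding grp_character_def continuous_map_def by auto

lemma omega_one: "\<omega> \<one> = 1"
  using omega_K KD(4) by simp

text \<open>These functions need not be left invariant under \<open>K\<close>. The larger class is used because the translates
  that make up a left convolution lose that invariance individually.\<close>

definition tw_cpt :: "('x \<Rightarrow> complex) \<Rightarrow> bool" where
  "tw_cpt \<phi> \<longleftrightarrow> rinv_cpt K (\<lambda>g. \<phi> (ract \<delta> g))"

text \<open>The factor \<open>\<omega>\<close> accounts for \<open>\<Pi>(\<delta> g) = \<omega>(g) \<Pi>(\<delta>) \<pi>(g)\<close>: with it a function \<open>\<phi>\<close> on the twisted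
  space acts as \<open>\<Pi>(\<delta>)\<close> after the action of \<open>pull \<phi>\<close>.\<close>

definition pull :: "('x \<Rightarrow> complex) \<Rightarrow> 'g \<Rightarrow> complex" where
  "pull \<phi> g = (if g \<in> carrier G then \<omega> g * \<phi> (ract \<delta> g) else 0)"

lemma tw_cpt_smooth:
  assumes "tw_cpt \<phi>" "\<gamma> \<in> tw_points X"
  shows "smooth_cpt (\<lambda>g. \<phi> (ract \<gamma> g))"
proof -
  obtain a where a: "a \<in> carrier G" "\<gamma> = ract \<delta> a" using ract_obtain[OF base assms(2)] .
  have "smooth_cpt (\<lambda>g. \<phi> (ract \<delta> g))"
    using assms(1) smooth_cptI[OF K] unfolding tw_cpt_def by blast
  from smooth_cpt_base_change(1)[where F = \<phi>, OF this base a(1)] show ?thesis unfolding a(2) .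
qed

lemma tw_cpt_ract:
  assumes "tw_cpt \<phi>" "\<gamma> \<in> tw_points X" "k \<in> K"
  shows "\<phi> (ract \<gamma> k) = \<phi> \<gamma>"
proof -
  obtain a where a: "a \<in> carrier G" "\<gamma> = ract \<delta> a" using ract_obtain[OF base assms(2)] .
  have "\<phi> (ract \<delta> (a \<otimes> k)) = \<phi> (ract \<delta> a)"
    using assms(1,3) a(1) by (simp add: tw_cpt_def rinv_cpt_def)
  thus ?thesis using ract_mult[OF a(1) KD(6)[OF assms(3)] base] a(2) by simp
qed

lemma tw_cptI:
  assumes g: "\<gamma> \<in> tw_points X" and phi: "smooth_cpt (\<lambda>g. \<phi> (ract \<gamma> g))"
    and right: "\<And>\<eta> k. \<eta> \<in> tw_points X \<Longrightarrow> k \<in> K \<Longrightarrow> \<phi> (ract \<eta> k) = \<phi> \<eta>"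
  shows "tw_cpt \<phi>"
proof -
  obtain a where a: "a \<in> carrier G" "\<delta> = ract \<gamma> a" using ract_obtain[OF g base] .
  have "smooth_cpt (\<lambda>g. \<phi> (ract \<delta> g))"
    using smooth_cpt_base_change(1)[where F = \<phi>, OF phi g a(1)] unfolding a(2) .
  thus ?thesis unfolding tw_cpt_def
    using ract_mult[OF _ KD(6) base] right[OF ract_closed[OF _ base]]
    by (intro smooth_cpt_rinv_cpt) simp_all
qed

lemma pull_rinv_cpt:
  assumes "tw_cpt \<phi>"
  shows "rinv_cpt K (pull \<phi>)"
proof -
  have phi: "rinv_cpt K (\<lambda>g. \<phi> (ract \<delta> g))" using assms by (simp add: tw_cpt_def)
  then obtain C where C: "compactin (grp_top G) C" "\<forall>x\<in>carrier G - C. \<phi> (ract \<delta> x) = 0"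
    unfolding rinv_cpt_def by (elim conjE exE)
  have "\<forall>x\<in>carrier G - C. pull \<phi> x = 0" using C(2) by (simp add: pull_def)
  moreover have "\<forall>x\<in>carrier G. \<forall>k\<in>K. pull \<phi> (x \<otimes> k) = pull \<phi> x"
    using phi KD(6) by (simp add: pull_def rinv_cpt_def omega_mult omega_K)
  ultimately show ?thesis using C(1) unfolding rinv_cpt_def by blast
qed

lemma pull_smooth: "tw_cpt \<phi> \<Longrightarrow> smooth_cpt (pull \<phi>)"
  by (rule smooth_cptI[OF K pull_rinv_cpt])

lemma base_K_obtain:
  assumes "k \<in> K"
  obtains l where "l \<in> K" "\<theta> \<delta> l = k"
proof -
  have "k \<in> \<theta> \<delta> ` K" using assms by (simp only: base_K)
  thus thesis by (rule imageE) (rule that, simp_all)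
qed

lemma
  assumes phi: "\<phi> \<in> tw_hecke X K"
  shows tw_hecke_tw_cpt: "tw_cpt \<phi>"
    and tw_hecke_left: "k \<in> K \<Longrightarrow> \<gamma> \<in> tw_points X \<Longrightarrow> \<phi> (lact k \<gamma>) = \<phi> \<gamma>"
proof -
  have bi: "\<phi> (ract (lact k \<gamma>) l) = \<phi> \<gamma>" if "k \<in> K" "\<gamma> \<in> tw_points X" "l \<in> K" for k \<gamma> l
    using phi that unfolding tw_hecke_def by simp
  obtain C where C: "compactin (tw_top X) C" "\<forall>x. x \<notin> C \<longrightarrow> \<phi> x = 0"
    using phi unfolding tw_hecke_def by blast
  let ?D = "{g \<in> carrier G. ract \<delta> g \<in> C}"
  have "(\<lambda>g. ract \<delta> g) ` ?D = C"
    using ract_onto[OF base] C(1) by (auto simp: compactin_def)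
  hence D: "compactin (grp_top G) ?D"
    using homeomorphic_map_compactness[OF homeomorphic_ract[OF base], of ?D] C(1) by simp
  have "\<phi> (ract \<delta> (x \<otimes> k)) = \<phi> (ract \<delta> x)" if "x \<in> carrier G" "k \<in> K" for x k
    using bi[OF KD(4) ract_closed[OF that(1) base] that(2)] ract_mult[OF that(1) KD(6)[OF that(2)] base]
    by (simp add: lact_one ract_closed[OF that(1) base])
  moreover have "\<forall>x\<in>carrier G - ?D. \<phi> (ract \<delta> x) = 0" using C(2) by simp
  ultimately show "tw_cpt \<phi>" unfolding tw_cpt_def rinv_cpt_def using D by blast
  show "\<phi> (lact k \<gamma>) = \<phi> \<gamma>" if "k \<in> K" "\<gamma> \<in> tw_points X"
    using bi[OF that KD(4)] ract_one[OF lact_closed[OF KD(6)[OF that(1)] that(2)]] by simp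
qed

lemma tw_heckeI:
  assumes phi: "tw_cpt \<phi>"
    and left: "\<And>k \<gamma>. k \<in> K \<Longrightarrow> \<gamma> \<in> tw_points X \<Longrightarrow> \<phi> (lact k \<gamma>) = \<phi> \<gamma>"
    and out: "\<And>\<gamma>. \<gamma> \<notin> tw_points X \<Longrightarrow> \<phi> \<gamma> = 0"
  shows "\<phi> \<in> tw_hecke X K"
proof -
  have "openin (tw_top X) {x \<in> tw_points X. \<phi> x \<in> U}" for U
  proof -
    have "{x \<in> tw_points X. \<phi> x \<in> U} = (\<lambda>g. ract \<delta> g) ` {g \<in> carrier G. \<phi> (ract \<delta> g) \<in> U}"
      using ract_onto[OF base] by auto
    thus ?thesis
      using homeomorphic_imp_open_map[OF homeomorphic_ract[OF base]]
        open_level_set[OF tw_cpt_smooth[OF phi base], of U] by (simp add: open_map_def)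
  qed
  hence "continuous_map (tw_top X) euclidean \<phi>" unfolding continuous_map_def by simp
  moreover have "\<exists>C. compactin (tw_top X) C \<and> (\<forall>x. x \<notin> C \<longrightarrow> \<phi> x = 0)"
  proof -
    obtain C where C: "compactin (grp_top G) C" "\<forall>x\<in>carrier G - C. \<phi> (ract \<delta> x) = 0"
      using phi unfolding tw_cpt_def rinv_cpt_def by (elim conjE exE)
    have "\<phi> x = 0" if "x \<notin> (\<lambda>g. ract \<delta> g) ` C" for x
    proof (cases "x \<in> tw_points X")
      case True
      then obtain g where "g \<in> carrier G" "x = ract \<delta> g" using ract_obtain[OF base] by blast
      thus ?thesis using C(2) that by blast
    qed (rule out)
    thus ?thesis
      using image_compactin[OF C(1) homeomorphic_imp_continuous_map[OF homeomorphic_ract[OF base]]]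
      by blast
  qed
  moreover have "\<forall>k\<in>K. \<forall>\<gamma>\<in>tw_points X. \<forall>l\<in>K. \<phi> (ract (lact k \<gamma>) l) = \<phi> \<gamma>"
    using tw_cpt_ract[OF phi lact_closed[OF KD(6)]] left by simp
  ultimately show ?thesis unfolding tw_hecke_def by blast
qed

lemma lact_base: "k \<in> K \<Longrightarrow> lact (\<theta> \<delta> k) (ract \<delta> g) = ract \<delta> (k \<otimes> g)" if "g \<in> carrier G" for g
  using ract_mult[OF KD(6) that base] ract_lact[OF int_closed[OF base KD(6)] that base]
  by (simp add: tw_ract_def[of X \<delta> k])

lemma pull_hecke:
  assumes phi: "\<phi> \<in> tw_hecke X K"
  shows "pull \<phi> \<in> hecke G K"
proof (rule heckeI[OF K pull_rinv_cpt[OF tw_hecke_tw_cpt[OF phi]]])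
  have "\<phi> (ract \<delta> (k \<otimes> x)) = \<phi> (ract \<delta> x)" if "k \<in> K" "x \<in> carrier G" for k x
    using tw_hecke_left[OF phi, of "\<theta> \<delta> k" "ract \<delta> x"] base_K that ract_closed[OF that(2) base]
      lact_base[OF that(2,1)] by auto
  thus "left_inv K (pull \<phi>)"
    using KD(6) by (simp add: left_inv_def pull_def omega_mult omega_K)
qed (simp add: pull_def)

text \<open>The function that corresponds to the unit of the Hecke algebra; it acts on fixed vectors
  as \<open>\<Pi>(\<delta>)\<close> itself.\<close>

definition tw_unit :: "'x \<Rightarrow> complex" where
  "tw_unit \<gamma> = (if \<gamma> \<in> (\<lambda>k. ract \<delta> k) ` K then complex_of_real (1 / measure M K) else 0)"

lemma tw_unit_base: "g \<in> carrier G \<Longrightarrow> tw_unit (ract \<delta> g) = hecke_unit M K g"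
  unfolding tw_unit_def hecke_unit_def
  using inj_on_image_mem_iff[OF ract_inj[OF base] _ KD(5)] by simp

lemma pull_unit: "g \<in> carrier G \<Longrightarrow> pull tw_unit g = hecke_unit M K g"
  using omega_K by (simp add: pull_def tw_unit_base hecke_unit_def)

lemma tw_unit_hecke: "tw_unit \<in> tw_hecke X K"
proof (rule tw_heckeI)
  show "tw_cpt tw_unit"
    unfolding tw_cpt_def
    using unit_rinv_cpt(1)[OF K] rinv_cpt_cong[OF K, of "\<lambda>g. tw_unit (ract \<delta> g)", OF tw_unit_base] by simp
  fix k \<gamma> assume k: "k \<in> K" and "\<gamma> \<in> tw_points X"
  then obtain g where g: "g \<in> carrier G" "\<gamma> = ract \<delta> g" using ract_obtain[OF base] by blast
  obtain l where l: "l \<in> K" "\<theta> \<delta> l = k" using base_K_obtain[OF k] .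
  show "tw_unit (lact k \<gamma>) = tw_unit \<gamma>"
    using lact_base[OF g(1) l(1)] l KD(6)[OF l(1)] g unit_rinv_cpt(2)[OF K]
    by (simp add: tw_unit_base left_inv_def)
next
  show "tw_unit \<gamma> = 0" if "\<gamma> \<notin> tw_points X" for \<gamma>
    using that ract_closed[OF KD(6) base] by (auto simp: tw_unit_def)
qed

lemma hecke_mult_omega:
  assumes "f \<in> hecke G K"
  shows "(\<lambda>x. \<omega> x * f x) \<in> hecke G K"
proof (rule heckeI[OF K])
  note f = hecke_rinv_cpt[OF K assms] hecke_left_inv[OF K assms] hecke_outside[OF K assms]
  obtain C where "compactin (grp_top G) C" "\<forall>x\<in>carrier G - C. f x = 0"
    using f(1) unfolding rinv_cpt_def by (elim conjE exE)
  moreover have "\<forall>x\<in>carrier G. \<forall>k\<in>K. \<omega> (x \<otimes> k) * f (x \<otimes> k) = \<omega> x * f x"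
    using f(1) KD(6) by (simp add: rinv_cpt_def omega_mult omega_K)
  ultimately show "rinv_cpt K (\<lambda>x. \<omega> x * f x)" unfolding rinv_cpt_def by auto
  show "left_inv K (\<lambda>x. \<omega> x * f x)"
    using f(2) KD(6) by (simp add: left_inv_def omega_mult omega_K)
  show "x \<notin> carrier G \<Longrightarrow> \<omega> x * f x = 0" for x using f(3) by simp
qed

section \<open>Convolution on the twisted space\<close>

text \<open>Substituting \<open>g\<close> by \<open>inv h \<otimes> g\<close> uses only left invariance of the measure, so no modular character
  enters.\<close>

lemma rconv_base:
  assumes phi: "tw_cpt \<phi>" and f: "f \<in> hecke G K" and h: "h \<in> carrier G"
  shows "hecke_rconv G X M \<phi> f (ract \<delta> h) = hecke_conv G M (\<lambda>g. \<phi> (ract \<delta> g)) f h"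
proof -
  let ?F = "\<lambda>g. \<phi> (ract \<delta> g) * f (inv g \<otimes> h)"
  have "rinv_cpt K (\<lambda>g. \<phi> (ract \<delta> g))" using phi by (simp add: tw_cpt_def)
  then obtain S where "adapted K S (\<lambda>g. \<phi> (ract \<delta> g))" by (rule rinv_cpt_adapted[OF K])
  hence F: "smooth_cpt ?F"
    using adapted_conv_integrand[OF _ hecke_left_inv[OF K f] h] adapted_smooth_cpt(2) by blast
  have "hecke_rconv G X M \<phi> f (ract \<delta> h) = (LINT g|M. \<phi> (ract (ract \<delta> h) g) * f (inv g))"
    using ract_closed[OF h base] by (simp add: hecke_rconv_def)
  also have "\<dots> = (LINT g|M. ?F (h \<otimes> g))"
    using h by (intro Bochner_Integration.integral_cong)
      (auto simp: ract_mult base inv_mult_group m_assoc)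
  also have "\<dots> = (LINT g|M. ?F g)"
    using Bochner_eq_lc_integral[OF F] Bochner_eq_lc_integral[OF smooth_cpt_translate[OF F h]]
      lc_integral_translate[OF F h] by simp
  finally show ?thesis using h by (simp add: hecke_conv_def)
qed

lemma pull_rconv:
  assumes phi: "tw_cpt \<phi>" and f: "f \<in> hecke G K" and h: "h \<in> carrier G"
  shows "pull (hecke_rconv G X M \<phi> f) h = hecke_conv G M (pull \<phi>) (\<lambda>x. \<omega> x * f x) h"
proof -
  have "hecke_conv G M (pull \<phi>) (\<lambda>x. \<omega> x * f x) h
      = (LINT g|M. \<omega> h * (\<phi> (ract \<delta> g) * f (inv g \<otimes> h)))"
    unfolding hecke_conv_def if_P[OF h]
  proof (rule Bochner_Integration.integral_cong[OF refl])
    fix g assume "g \<in> space M"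
    hence g: "g \<in> carrier G" by simp
    have "\<omega> h = \<omega> (g \<otimes> (inv g \<otimes> h))" using g h by simp
    also have "\<dots> = \<omega> g * \<omega> (inv g \<otimes> h)" using g h by (intro omega_mult) simp_all
    finally have "\<omega> h = \<omega> g * \<omega> (inv g \<otimes> h)" .
    thus "pull \<phi> g * (\<omega> (inv g \<otimes> h) * f (inv g \<otimes> h)) = \<omega> h * (\<phi> (ract \<delta> g) * f (inv g \<otimes> h))"
      using g by (simp add: pull_def)
  qed
  also have "\<dots> = \<omega> h * hecke_conv G M (\<lambda>g. \<phi> (ract \<delta> g)) f h"
    using h by (simp add: hecke_conv_def)
  finally show ?thesis using rconv_base[OF phi f h] h by (simp add: pull_def)
qed

lemma tw_cpt_rconv:
  assumes phi: "tw_cpt \<phi>" and f: "f \<in> hecke G K"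
  shows "tw_cpt (hecke_rconv G X M \<phi> f)"
proof -
  have r: "rinv_cpt K (\<lambda>g. \<phi> (ract \<delta> g))" using phi by (simp add: tw_cpt_def)
  then obtain S where S: "adapted K S (\<lambda>g. \<phi> (ract \<delta> g))" by (rule rinv_cpt_adapted[OF K])
  have "rinv_cpt K (hecke_conv G M (\<lambda>g. \<phi> (ract \<delta> g)) f)"
    using smooth_cpt_conv[OF S hecke_left_inv[OF K f] hecke_smooth_cpt[OF K f]]
      right_inv_conv[OF K hecke_rinv_cpt[OF K f]]
    by (rule smooth_cpt_rinv_cpt)
  thus ?thesis unfolding tw_cpt_def
    using rinv_cpt_cong[OF K, of "\<lambda>g. hecke_rconv G X M \<phi> f (ract \<delta> g)", OF rconv_base[OF phi f]]
    by simp
qed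

text \<open>Left invariance of \<open>\<phi>\<close> under \<open>K\<close> makes the integrand constant on the cosets of \<open>K\<close>.\<close>

lemma lconv_sum:
  assumes phi: "\<phi> \<in> tw_hecke X K" and f: "adapted K S f" and g: "\<gamma> \<in> tw_points X"
  shows "hecke_lconv G X M f \<phi> \<gamma>
    = (\<Sum>s\<in>S. (complex_of_real (measure M K) * f s) * \<phi> (lact (inv s) \<gamma>))"
proof -
  have "f (x \<otimes> k) * \<phi> (lact (inv (x \<otimes> k)) \<gamma>) = f x * \<phi> (lact (inv x) \<gamma>)"
    if "x \<in> carrier G" "k \<in> K" for x k
  proof -
    have "lact (inv (x \<otimes> k)) \<gamma> = lact (inv k) (lact (inv x) \<gamma>)"
      using that KD(6) g by (simp add: inv_mult_group lact_mult)
    hence "\<phi> (lact (inv (x \<otimes> k)) \<gamma>) = \<phi> (lact (inv x) \<gamma>)"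
      using tw_hecke_left[OF phi KD(7)[OF that(2)] lact_closed[OF _ g]] that(1) by simp
    thus ?thesis using f that by (simp add: adapted_def)
  qed
  hence "adapted K S (\<lambda>x. f x * \<phi> (lact (inv x) \<gamma>))" using f by (simp add: adapted_def)
  from Bochner_integral_adapted[OF this] show ?thesis
    using g by (simp add: hecke_lconv_def mult.assoc)
qed

lemma tw_cpt_translate:
  assumes phi: "tw_cpt \<phi>" and s: "s \<in> carrier G"
  shows "tw_cpt (\<lambda>\<gamma>. \<phi> (lact (inv s) \<gamma>))"
proof (rule tw_cptI[OF lact_closed[OF s base]])
  have "\<phi> (lact (inv s) (ract (lact s \<delta>) g)) = \<phi> (ract \<delta> g)" if "g \<in> carrier G" for g
    using s that base ract_closed[OF that base]
    by (simp add: ract_lact lact_one flip: lact_mult)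
  thus "smooth_cpt (\<lambda>g. \<phi> (lact (inv s) (ract (lact s \<delta>) g)))"
    using smooth_cpt_cong[of "\<lambda>g. \<phi> (lact (inv s) (ract (lact s \<delta>) g))" "\<lambda>g. \<phi> (ract \<delta> g)"]
      tw_cpt_smooth[OF phi base] by simp
  show "\<phi> (lact (inv s) (ract \<eta> k)) = \<phi> (lact (inv s) \<eta>)" if "\<eta> \<in> tw_points X" "k \<in> K" for \<eta> k
    using tw_cpt_ract[OF phi lact_closed[OF _ that(1)] that(2), of "inv s"] s
      ract_lact[OF _ KD(6)[OF that(2)] that(1), of "inv s"] by simp
qed

lemma tw_cpt_cong:
  assumes "\<And>\<gamma>. \<gamma> \<in> tw_points X \<Longrightarrow> \<phi> \<gamma> = \<psi> \<gamma>"
  shows "tw_cpt \<phi> \<longleftrightarrow> tw_cpt \<psi>"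
  unfolding tw_cpt_def using assms ract_closed[OF _ base] by (intro rinv_cpt_cong[OF K]) simp

lemma tw_cpt_scale:
  assumes "tw_cpt \<phi>" shows "tw_cpt (\<lambda>\<gamma>. c * \<phi> \<gamma>)"
  using assms unfolding tw_cpt_def rinv_cpt_def by auto

lemma tw_cpt_sum:
  assumes "finite I" "\<And>i. i \<in> I \<Longrightarrow> tw_cpt (\<phi> i)"
  shows "tw_cpt (\<lambda>\<gamma>. \<Sum>i\<in>I. \<phi> i \<gamma>)"
proof (rule tw_cptI[OF base])
  show "smooth_cpt (\<lambda>g. \<Sum>i\<in>I. \<phi> i (ract \<delta> g))"
    using tw_cpt_smooth[OF assms(2) base] by (rule smooth_cpt_sum[OF assms(1)])
  show "(\<Sum>i\<in>I. \<phi> i (ract \<eta> k)) = (\<Sum>i\<in>I. \<phi> i \<eta>)" if "\<eta> \<in> tw_points X" "k \<in> K" for \<eta> k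
    using tw_cpt_ract[OF assms(2) that] by (rule sum.cong[OF refl])
qed

lemma tw_cpt_lconv:
  assumes phi: "\<phi> \<in> tw_hecke X K" and f: "adapted K S f"
  shows "tw_cpt (hecke_lconv G X M f \<phi>)"
proof -
  have "tw_cpt (\<lambda>\<gamma>. \<Sum>s\<in>S. (complex_of_real (measure M K) * f s) * \<phi> (lact (inv s) \<gamma>))"
    by (rule tw_cpt_sum[OF adapted_self(2)[OF f]], rule tw_cpt_scale,
        rule tw_cpt_translate[OF tw_hecke_tw_cpt[OF phi] adapted_self(3)[OF f]])
  thus ?thesis using tw_cpt_cong[of "hecke_lconv G X M f \<phi>", OF lconv_sum[OF phi f]] by simp
qed

end

section \<open>The module of fixed vectors\<close>

locale twisted_rep = twisted_level G M X \<omega> K \<delta> for G :: "'g top_group" (structure) and M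
  and X :: "('g, 'x) twisted" and \<omega> K \<delta> +
  fixes R :: "('g, 'x, 'v::ab_group_add) tw_rep"
  assumes omega_rep: "smooth_omega_rep G X \<omega> R"
begin

sublocale haar_rep G M "rep_scale R" "rep_grp R"
  using omega_rep by unfold_locales (simp add: smooth_omega_rep_def)

abbreviation "sc \<equiv> rep_scale R"
abbreviation "\<pi> \<equiv> rep_grp R"
abbreviation "\<tau> \<equiv> rep_tw R"
abbreviation "V \<equiv> fixed_module X M R K"

lemma
  assumes "\<gamma> \<in> tw_points X"
  shows tw_linear: "Vector_Spaces.linear sc sc (\<tau> \<gamma>)" and tw_bij: "bij (\<tau> \<gamma>)"
  using omega_rep assms by (simp_all add: smooth_omega_rep_def)

lemma tw_simps:
  assumes "\<gamma> \<in> tw_points X"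
  shows "\<tau> \<gamma> (v + w) = \<tau> \<gamma> v + \<tau> \<gamma> w" "\<tau> \<gamma> (sc c v) = sc c (\<tau> \<gamma> v)" "\<tau> \<gamma> 0 = 0"
proof -
  interpret A: Vector_Spaces.linear sc sc "\<tau> \<gamma>" using tw_linear[OF assms] .
  show "\<tau> \<gamma> (v + w) = \<tau> \<gamma> v + \<tau> \<gamma> w" "\<tau> \<gamma> (sc c v) = sc c (\<tau> \<gamma> v)" "\<tau> \<gamma> 0 = 0"
    by (simp_all add: A.add A.scale A.zero)
qed

lemma tw_equivariant:
  "x \<in> carrier G \<Longrightarrow> \<gamma> \<in> tw_points X \<Longrightarrow> y \<in> carrier G \<Longrightarrow>
    \<tau> (ract (lact x \<gamma>) y) v = sc (\<omega> y) (\<pi> x (\<tau> \<gamma> (\<pi> y v)))"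
  using omega_rep unfolding smooth_omega_rep_def by blast

lemma tw_lact: "x \<in> carrier G \<Longrightarrow> \<gamma> \<in> tw_points X \<Longrightarrow> \<tau> (lact x \<gamma>) v = \<pi> x (\<tau> \<gamma> v)"
  using tw_equivariant[of x \<gamma> \<one> v] by (simp add: ract_one lact_closed omega_one rep_one)

lemma tw_ract: "y \<in> carrier G \<Longrightarrow> \<gamma> \<in> tw_points X \<Longrightarrow> \<tau> (ract \<gamma> y) v = sc (\<omega> y) (\<tau> \<gamma> (\<pi> y v))"
  using tw_equivariant[of \<one> \<gamma> y v] by (simp add: lact_one rep_one)

lemma tw_rep_commute:
  assumes "y \<in> carrier G"
  shows "\<tau> \<delta> (\<pi> y v) = sc (inverse (\<omega> y)) (\<pi> (\<theta> \<delta> y) (\<tau> \<delta> v))"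
  using tw_ract[OF assms base, of v] tw_lact[OF int_closed[OF base assms] base, of v]
    omega_nonzero[OF assms] by (simp add: tw_ract_def)

lemma fixed_module_simps:
  "mod_scale V = sc" "mod_carrier V = fixed K" "mod_hecke V = act"
  "mod_tw V \<phi> v = lc_integral (tw_measure X M) sc (\<lambda>\<gamma>. sc (\<phi> \<gamma>) (\<tau> \<gamma> v))"
  by (simp_all add: fixed_module_def fixed_vectors_def fixed_def hecke_act_def[abs_def])

text \<open>Here \<open>\<gamma>\<close> is arbitrary. Translating a function by \<open>s\<close> is then harmless: one passes
  from the base point \<open>\<gamma>\<close> to \<open>s \<gamma>\<close>.\<close>

lemma mod_tw_base:
  assumes phi: "tw_cpt \<phi>" and g: "\<gamma> \<in> tw_points X"
  shows "mod_tw V \<phi> v = \<tau> \<gamma> (act (\<lambda>g. \<omega> g * \<phi> (ract \<gamma> g)) v)"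
    and "smooth_cpt (\<lambda>g. \<omega> g * \<phi> (ract \<gamma> g))"
proof -
  let ?f = "\<lambda>g. \<omega> g * \<phi> (ract \<gamma> g)"
  show f: "smooth_cpt ?f"
  proof (rule smooth_cptI[OF K])
    obtain C where C: "compactin (grp_top G) C" "\<forall>x\<in>carrier G - C. \<phi> (ract \<gamma> x) = 0"
      using tw_cpt_smooth[OF phi g] unfolding smooth_cpt_def rinv_cpt_def by (elim conjE exE)
    moreover have "\<forall>x\<in>carrier G. \<forall>k\<in>K. ?f (x \<otimes> k) = ?f x"
      using tw_cpt_ract[OF phi ract_closed[OF _ g]] KD(6) g
      by (simp add: ract_mult omega_mult omega_K)
    ultimately show "rinv_cpt K ?f" unfolding rinv_cpt_def by auto
  qed
  have eq: "sc (\<phi> (ract \<gamma> h)) (\<tau> (ract \<gamma> h) v) = \<tau> \<gamma> (sc (?f h) (\<pi> h v))" if "h \<in> carrier G" for h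
    using that g by (simp add: tw_ract tw_simps mult.commute)
  have "smooth_cpt (\<lambda>h. sc (\<phi> (ract \<gamma> h)) (\<tau> (ract \<gamma> h) v))"
    using smooth_cpt_linear[OF smooth_cpt_act[OF f] tw_linear[OF g]]
      smooth_cpt_cong[of "\<lambda>h. sc (\<phi> (ract \<gamma> h)) (\<tau> (ract \<gamma> h) v)", OF eq] by simp
  hence "mod_tw V \<phi> v = lc_integral M sc (\<lambda>h. sc (\<phi> (ract \<gamma> h)) (\<tau> (ract \<gamma> h) v))"
    unfolding fixed_module_simps
    by (rule lc_integral_tw_measure[where F = "\<lambda>\<gamma>. sc (\<phi> \<gamma>) (\<tau> \<gamma> v)", OF _ g])
  also have "\<dots> = lc_integral M sc (\<lambda>h. \<tau> \<gamma> (sc (?f h) (\<pi> h v)))"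
    by (rule lc_integral_cong) (rule eq)
  also have "\<dots> = \<tau> \<gamma> (act ?f v)"
    unfolding hecke_act_def by (rule lc_integral_linear[OF smooth_cpt_act[OF f] tw_linear[OF g]])
  finally show "mod_tw V \<phi> v = \<tau> \<gamma> (act ?f v)" .
qed

lemma mod_tw_pull:
  assumes "tw_cpt \<phi>"
  shows "mod_tw V \<phi> v = \<tau> \<delta> (act (pull \<phi>) v)"
  unfolding mod_tw_base(1)[OF assms base]
  by (rule arg_cong[where f = "\<tau> \<delta>"], rule act_cong) (simp add: pull_def)

lemma mod_tw_unit: "v \<in> fixed K \<Longrightarrow> mod_tw V tw_unit v = \<tau> \<delta> v"
  unfolding mod_tw_pull[OF tw_hecke_tw_cpt[OF tw_unit_hecke]]
  using act_cong[OF pull_unit] act_unit[OF K] by simp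

lemma mod_tw_translate:
  assumes phi: "tw_cpt \<phi>" and s: "s \<in> carrier G"
  shows "mod_tw V (\<lambda>\<gamma>. \<phi> (lact (inv s) \<gamma>)) v = \<pi> s (mod_tw V \<phi> v)"
proof -
  have eq: "\<phi> (lact (inv s) (ract (lact s \<delta>) g)) = \<phi> (ract \<delta> g)" if "g \<in> carrier G" for g
    using s that base ract_closed[OF that base]
    by (simp add: ract_lact lact_one flip: lact_mult)
  have "mod_tw V (\<lambda>\<gamma>. \<phi> (lact (inv s) \<gamma>)) v = \<tau> (lact s \<delta>) (act (\<lambda>g. \<omega> g * \<phi> (ract \<delta> g)) v)"
    unfolding mod_tw_base(1)[OF tw_cpt_translate[OF phi s] lact_closed[OF s base]]
    by (rule arg_cong[where f = "\<tau> (lact s \<delta>)"], rule act_cong) (simp add: eq)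
  thus ?thesis using tw_lact[OF s base] mod_tw_base(1)[OF phi base] by simp
qed

lemma mod_tw_cong:
  assumes "\<And>\<gamma>. \<gamma> \<in> tw_points X \<Longrightarrow> \<phi> \<gamma> = \<psi> \<gamma>" "tw_cpt \<phi>"
  shows "mod_tw V \<phi> v = mod_tw V \<psi> v"
proof -
  have "tw_cpt \<psi>" using tw_cpt_cong[of \<phi> \<psi>] assms by blast
  thus ?thesis unfolding mod_tw_pull[OF assms(2)] mod_tw_pull[OF \<open>tw_cpt \<psi>\<close>]
    using assms(1) ract_closed[OF _ base]
    by (intro arg_cong[where f = "\<tau> \<delta>"] act_cong) (simp add: pull_def)
qed

lemma mod_tw_scale:
  assumes "tw_cpt \<phi>"
  shows "mod_tw V (\<lambda>\<gamma>. c * \<phi> \<gamma>) v = sc c (mod_tw V \<phi> v)"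
proof -
  have "pull (\<lambda>\<gamma>. c * \<phi> \<gamma>) = (\<lambda>g. c * pull \<phi> g)" by (auto simp: pull_def)
  thus ?thesis
    by (simp add: mod_tw_pull tw_cpt_scale assms act_scale_left pull_smooth tw_simps base)
qed

lemma tw_cpt_add: "tw_cpt \<phi> \<Longrightarrow> tw_cpt \<psi> \<Longrightarrow> tw_cpt (\<lambda>\<gamma>. \<phi> \<gamma> + \<psi> \<gamma>)"
  unfolding tw_cpt_def by (rule rinv_cpt_add)

lemma mod_tw_add:
  assumes "tw_cpt \<phi>" "tw_cpt \<psi>"
  shows "mod_tw V (\<lambda>\<gamma>. \<phi> \<gamma> + \<psi> \<gamma>) v = mod_tw V \<phi> v + mod_tw V \<psi> v"
proof -
  have "pull (\<lambda>\<gamma>. \<phi> \<gamma> + \<psi> \<gamma>) = (\<lambda>g. pull \<phi> g + pull \<psi> g)"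
    by (auto simp: pull_def distrib_left)
  thus ?thesis
    by (simp add: mod_tw_pull tw_cpt_add assms act_add_left pull_smooth tw_simps base)
qed

lemma mod_tw_sum:
  assumes "finite I" "\<And>i. i \<in> I \<Longrightarrow> tw_cpt (\<phi> i)"
  shows "mod_tw V (\<lambda>\<gamma>. \<Sum>i\<in>I. \<phi> i \<gamma>) v = (\<Sum>i\<in>I. mod_tw V (\<phi> i) v)"
  using assms
proof (induction I rule: finite_induct)
  case empty
  show ?case by (simp add: fixed_module_simps(4) lc_integral_def)
next
  case (insert i I)
  thus ?case using mod_tw_add[OF _ tw_cpt_sum, of "\<phi> i" I \<phi>] by simp
qed

lemma mod_tw_fixed:
  assumes phi: "\<phi> \<in> tw_hecke X K"
  shows "mod_tw V \<phi> v \<in> fixed K"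
proof -
  note c = tw_hecke_tw_cpt[OF phi]
  have "\<pi> k (mod_tw V \<phi> v) = mod_tw V \<phi> v" if k: "k \<in> K" for k
  proof -
    have "\<pi> k (mod_tw V \<phi> v) = mod_tw V (\<lambda>\<gamma>. \<phi> (lact (inv k) \<gamma>)) v"
      using mod_tw_translate[OF c KD(6)[OF k]] by simp
    also have "\<dots> = mod_tw V \<phi> v"
      by (rule mod_tw_cong[OF _ tw_cpt_translate[OF c KD(6)[OF k]]])
        (rule tw_hecke_left[OF phi KD(7)[OF k]])
    finally show ?thesis .
  qed
  thus ?thesis by (simp add: fixed_def)
qed

lemma mod_tw_lconv:
  assumes phi: "\<phi> \<in> tw_hecke X K" and f: "f \<in> hecke G K"
  shows "mod_tw V (hecke_lconv G X M f \<phi>) v = act f (mod_tw V \<phi> v)"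
proof -
  obtain S where S: "adapted K S f" using rinv_cpt_adapted[OF K hecke_rinv_cpt[OF K f]] .
  note c = tw_hecke_tw_cpt[OF phi]
  let ?a = "\<lambda>s. complex_of_real (measure M K) * f s"
  note t = tw_cpt_translate[OF c adapted_self(3)[OF S]]
  have "mod_tw V (hecke_lconv G X M f \<phi>) v
      = mod_tw V (\<lambda>\<gamma>. \<Sum>s\<in>S. ?a s * \<phi> (lact (inv s) \<gamma>)) v"
    using mod_tw_cong[OF lconv_sum[OF phi S] tw_cpt_lconv[OF phi S]] .
  also have "\<dots> = (\<Sum>s\<in>S. mod_tw V (\<lambda>\<gamma>. ?a s * \<phi> (lact (inv s) \<gamma>)) v)"
    by (rule mod_tw_sum[OF adapted_self(2)[OF S] tw_cpt_scale[OF t]])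
  also have "\<dots> = (\<Sum>s\<in>S. sc (?a s) (\<pi> s (mod_tw V \<phi> v)))"
    by (rule sum.cong[OF refl]) (simp only: mod_tw_scale[OF t] mod_tw_translate[OF c adapted_self(3)[OF S]])
  also have "\<dots> = act f (mod_tw V \<phi> v)"
    using act_adapted[OF S mod_tw_fixed[OF phi]] by simp
  finally show ?thesis .
qed

lemma mod_tw_rconv:
  assumes phi: "tw_cpt \<phi>" and f: "f \<in> hecke G K"
  shows "mod_tw V (hecke_rconv G X M \<phi> f) v = mod_tw V \<phi> (act (\<lambda>x. \<omega> x * f x) v)"
proof -
  note of = hecke_mult_omega[OF f]
  obtain S where S: "adapted K S (pull \<phi>)"
    using rinv_cpt_adapted[OF K pull_rinv_cpt[OF phi]] .
  have "act (pull (hecke_rconv G X M \<phi> f)) v = act (hecke_conv G M (pull \<phi>) (\<lambda>x. \<omega> x * f x)) v"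
    by (rule act_cong) (rule pull_rconv[OF phi f])
  also have "\<dots> = act (pull \<phi>) (act (\<lambda>x. \<omega> x * f x) v)"
    using act_conv[OF S hecke_left_inv[OF K of] hecke_smooth_cpt[OF K of]] .
  finally show ?thesis unfolding mod_tw_pull[OF phi] mod_tw_pull[OF tw_cpt_rconv[OF phi f]] by simp
qed

lemma act_simps:
  assumes "smooth_cpt f"
  shows "act f (v + w) = act f v + act f w" "act f (sc c v) = sc c (act f v)"
proof -
  interpret A: Vector_Spaces.linear sc sc "act f" using act_linear[OF assms] .
  show "act f (v + w) = act f v + act f w" "act f (sc c v) = sc c (act f v)"
    by (simp_all add: A.add A.scale)
qed

lemma hecke_bilinear: "bilinear_action sc (hecke G K) (fixed K) act"
  unfolding bilinear_action_def
  using hecke_smooth_cpt[OF K] hecke_left_inv[OF K]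
  by (simp add: act_fixed[OF K] act_simps act_add_left act_scale_left)

lemma tw_bilinear: "bilinear_action sc (tw_hecke X K) (fixed K) (mod_tw V)"
  unfolding bilinear_action_def
  using tw_hecke_tw_cpt
  by (simp add: mod_tw_fixed mod_tw_add mod_tw_scale)
     (simp add: mod_tw_pull act_simps pull_smooth tw_simps base)

lemma hecke_act_conv:
  assumes f: "f \<in> hecke G K" and f': "f' \<in> hecke G K"
  shows "act (hecke_conv G M f f') v = act f (act f' v)"
proof -
  obtain S where S: "adapted K S f"
    using rinv_cpt_adapted[OF K hecke_rinv_cpt[OF K f]] .
  show ?thesis using act_conv[OF S hecke_left_inv[OF K f'] hecke_smooth_cpt[OF K f']] .
qed

text \<open>The bimodule law splits into the compatibilities with left and with right convolution; the
  second applies to the left convolution because it needs no more than membership in \<open>tw_cpt\<close>.\<close>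

lemma fixed_module_is_tw_module: "tw_module G X M \<omega> K V"
proof -
  have lconv: "tw_cpt (hecke_lconv G X M f \<phi>)" if f: "f \<in> hecke G K" and phi: "\<phi> \<in> tw_hecke X K" for f \<phi>
  proof -
    obtain S where "adapted K S f"
      using rinv_cpt_adapted[OF K hecke_rinv_cpt[OF K f]] .
    thus ?thesis using tw_cpt_lconv[OF phi] by blast
  qed
  show ?thesis
    unfolding tw_module_def hecke_module_def fixed_module_simps(1-3)
    using vector_space_axioms subspace_fixed[OF KD(5)] hecke_bilinear tw_bilinear hecke_act_conv
      act_unit[OF K] mod_tw_rconv[OF lconv] mod_tw_lconv by simp
qed

section \<open>Simple modules and irreducible representations\<close>

text \<open>Stability under \<open>\<Pi>(\<delta>)\<close> is a special case of the module law, \<open>\<Pi>(\<delta>)\<close> being the action of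
  \<open>tw_unit\<close>. Conversely a preimage of a fixed vector is fixed, because \<open>\<Pi>(\<delta>)\<close> is injective and
  carries the action of \<open>k\<close> to that of \<open>\<theta> \<delta> k\<close>.\<close>

lemma base_fixed: "\<tau> \<delta> ` fixed K = fixed K"
proof (intro equalityI subsetI)
  fix v assume "v \<in> \<tau> \<delta> ` fixed K"
  then obtain u where u: "u \<in> fixed K" "v = \<tau> \<delta> u" by blast
  show "v \<in> fixed K"
    using mod_tw_fixed[OF tw_unit_hecke, of u] mod_tw_unit[OF u(1)] u(2) by simp
next
  fix v assume v: "v \<in> fixed K"
  obtain u where u: "v = \<tau> \<delta> u" using bij_is_surj[OF tw_bij[OF base]] by blast
  have "\<pi> k u = u" if k: "k \<in> K" for k
  proof -
    have "\<theta> \<delta> k \<in> K" using base_K k by blast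
    hence "\<tau> \<delta> (\<pi> k u) = \<tau> \<delta> u"
      using v u tw_rep_commute[OF KD(6)[OF k], of u] omega_K[OF k] by (simp add: fixed_def)
    thus ?thesis using bij_is_inj[OF tw_bij[OF base]] by (simp add: inj_eq)
  qed
  thus "v \<in> \<tau> \<delta> ` fixed K" using u by (auto simp: fixed_def)
qed

lemma hecke_submodule_iff:
  "hecke_submodule G K V W \<longleftrightarrow> W \<subseteq> fixed K \<and> subspace W \<and> (\<forall>f\<in>hecke G K. \<forall>w\<in>W. act f w \<in> W)"
  unfolding hecke_submodule_def fixed_module_simps(1-3) ..

text \<open>The action of \<open>\<phi>\<close> is an element of the Hecke algebra followed by \<open>\<Pi>(\<delta>)\<close>, and \<open>tw_unit\<close> realizes
  \<open>\<Pi>(\<delta>)\<close> alone. The twisted bimodule thus contributes a single bijective operator.\<close>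

lemma tw_span_submodule:
  assumes W: "hecke_submodule G K V W"
  shows "tw_span X K V W = \<tau> \<delta> ` W"
proof -
  interpret T: Vector_Spaces.linear sc sc "\<tau> \<delta>" using tw_linear[OF base] .
  note W' = W[unfolded hecke_submodule_iff]
  have "span {mod_tw V \<phi> w | \<phi> w. \<phi> \<in> tw_hecke X K \<and> w \<in> W} = \<tau> \<delta> ` W"
  proof (intro equalityI)
    have "{mod_tw V \<phi> w | \<phi> w. \<phi> \<in> tw_hecke X K \<and> w \<in> W} \<subseteq> \<tau> \<delta> ` W"
      using W' pull_hecke by (auto simp: mod_tw_pull[OF tw_hecke_tw_cpt])
    thus "span {mod_tw V \<phi> w | \<phi> w. \<phi> \<in> tw_hecke X K \<and> w \<in> W} \<subseteq> \<tau> \<delta> ` W"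
      using T.subspace_image[of W] W' by (intro span_minimal) simp_all
    show "\<tau> \<delta> ` W \<subseteq> span {mod_tw V \<phi> w | \<phi> w. \<phi> \<in> tw_hecke X K \<and> w \<in> W}"
    proof
      fix v assume "v \<in> \<tau> \<delta> ` W"
      then obtain w where w: "w \<in> W" "v = \<tau> \<delta> w" by blast
      hence "v = mod_tw V tw_unit w" using mod_tw_unit W' by auto
      hence "v \<in> {mod_tw V \<phi> w | \<phi> w. \<phi> \<in> tw_hecke X K \<and> w \<in> W}"
        using w(1) tw_unit_hecke by (intro CollectI exI conjI)
      thus "v \<in> span {mod_tw V \<phi> w | \<phi> w. \<phi> \<in> tw_hecke X K \<and> w \<in> W}" by (rule span_base)
    qed
  qed
  thus ?thesis unfolding tw_span_def fixed_module_simps(1) .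
qed

lemma fixed_submodule: "hecke_submodule G K V (fixed K)"
  unfolding hecke_submodule_iff
  using subspace_fixed[OF KD(5)] hecke_smooth_cpt[OF K] hecke_left_inv[OF K] act_fixed[OF K] by blast

lemma simple_iff:
  "simple_tw_module G X M \<omega> K V \<longleftrightarrow> fixed K \<noteq> {0} \<and>
    (\<forall>W. hecke_submodule G K V W \<and> W \<noteq> {0} \<and> \<tau> \<delta> ` W = W \<longrightarrow> W = fixed K)"
proof -
  have "nondegenerate X K V"
    unfolding nondegenerate_def fixed_module_simps(2) tw_span_submodule[OF fixed_submodule]
    by (rule base_fixed)
  thus ?thesis
    unfolding simple_tw_module_def fixed_module_simps(2)
    using fixed_module_is_tw_module tw_span_submodule by metis
qed

definition generated :: "'v set \<Rightarrow> 'v set" where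
  "generated W = span {\<pi> g w | g w. g \<in> carrier G \<and> w \<in> W}"

text \<open>Every point of the twisted space is \<open>x \<delta>\<close> with \<open>x\<close> in \<open>G\<close>, and \<open>\<Pi>(\<delta>) \<pi>(y) w\<close> is a scalar multiple
  of \<open>\<pi>(\<theta> \<delta> y) \<Pi>(\<delta>) w\<close>. Equality, rather than inclusion, uses that \<open>\<Pi>(\<delta>)\<close> maps \<open>W\<close> onto itself.\<close>

lemma generated_tw_stable:
  assumes W: "\<tau> \<delta> ` W = W" and g: "\<gamma> \<in> tw_points X"
  shows "\<tau> \<gamma> ` generated W = generated W"
proof -
  obtain x where x: "x \<in> carrier G" "\<gamma> = lact x \<delta>" using lact_obtain[OF base g] .
  interpret A: Vector_Spaces.linear sc sc "\<tau> \<gamma>" using tw_linear[OF g] .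
  let ?gens = "{\<pi> g w | g w. g \<in> carrier G \<and> w \<in> W}"
  have sub: "subspace (generated W)" unfolding generated_def by (rule subspace_span)
  have gen: "\<pi> y w \<in> generated W" if "y \<in> carrier G" "w \<in> W" for y w
    unfolding generated_def by (rule span_base) (use that in blast)
  have act_gen: "\<tau> \<gamma> (\<pi> y w) = sc (inverse (\<omega> y)) (\<pi> (x \<otimes> \<theta> \<delta> y) (\<tau> \<delta> w))"
    if "y \<in> carrier G" for y w
    using x that int_closed[OF base that]
    by (simp add: tw_lact[OF x(1) base] tw_rep_commute rep_simps rep_mult)
  show ?thesis
  proof (rule equalityI)
    have "?gens \<subseteq> \<tau> \<gamma> -` generated W"
    proof
      fix v assume "v \<in> ?gens"
      then obtain y w where v: "v = \<pi> y w" "y \<in> carrier G" "w \<in> W" by blast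
      have "\<tau> \<delta> w \<in> W" using W v(3) by blast
      thus "v \<in> \<tau> \<gamma> -` generated W"
        using v x(1) int_closed[OF base v(2)]
        by (simp add: act_gen subspace_scale[OF sub] gen)
    qed
    hence "span ?gens \<subseteq> \<tau> \<gamma> -` generated W"
      using A.subspace_vimage[OF sub] by (rule span_minimal)
    thus "\<tau> \<gamma> ` generated W \<subseteq> generated W" unfolding generated_def by blast
    have "?gens \<subseteq> \<tau> \<gamma> ` generated W"
    proof
      fix v assume "v \<in> ?gens"
      then obtain y w where v: "v = \<pi> y w" "y \<in> carrier G" "w \<in> W" by blast
      then obtain u where u: "u \<in> W" "w = \<tau> \<delta> u" using W by blast
      have "inv x \<otimes> y \<in> \<theta> \<delta> ` carrier G" using int_onto[OF base] x v by simp
      then obtain h where h: "h \<in> carrier G" "\<theta> \<delta> h = inv x \<otimes> y" by (metis imageE)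
      have "\<tau> \<gamma> (sc (\<omega> h) (\<pi> h u)) = sc (\<omega> h) (\<tau> \<gamma> (\<pi> h u))" by (rule A.scale)
      also have "\<dots> = \<pi> (x \<otimes> \<theta> \<delta> h) (\<tau> \<delta> u)"
        unfolding act_gen[OF h(1)] using omega_nonzero[OF h(1)] by simp
      also have "\<dots> = v" using h(2) u(2) v(1,2) x(1) by simp
      finally have "\<tau> \<gamma> (sc (\<omega> h) (\<pi> h u)) = v" .
      moreover have "sc (\<omega> h) (\<pi> h u) \<in> generated W"
        using h(1) u(1) by (intro subspace_scale[OF sub] gen)
      ultimately show "v \<in> \<tau> \<gamma> ` generated W" by (metis imageI)
    qed
    thus "generated W \<subseteq> \<tau> \<gamma> ` generated W"
      using A.subspace_image[OF sub] unfolding generated_def by (rule span_minimal)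
  qed
qed

lemma
  assumes W: "hecke_submodule G K V W"
  shows generated_fixed: "generated W \<inter> fixed K = W" and generated_superset: "W \<subseteq> generated W"
proof -
  show "generated W \<inter> fixed K = W"
    unfolding generated_def using W[unfolded hecke_submodule_iff] by (intro hecke_span_fixed[OF K]) simp_all
  thus "W \<subseteq> generated W" by blast
qed

text \<open>The subspace generated by \<open>W\<close> is everything, and its fixed vectors are those in \<open>W\<close>.\<close>

lemma irreducible_imp_simple:
  assumes irr: "rep_irreducible X R" and ne: "fixed K \<noteq> {0}"
  shows "simple_tw_module G X M \<omega> K V"
  unfolding simple_iff
proof (intro conjI allI impI ne)
  fix W assume W: "hecke_submodule G K V W \<and> W \<noteq> {0} \<and> \<tau> \<delta> ` W = W"
  have "0 \<in> W" using W subspace_0 by (simp add: hecke_submodule_iff)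
  hence "generated W \<noteq> {0}" using W generated_superset[of W] by blast
  moreover have "subspace (generated W)" by (simp add: generated_def)
  moreover have "\<forall>\<gamma>\<in>tw_points X. \<tau> \<gamma> ` generated W = generated W"
    using generated_tw_stable W by blast
  ultimately have "generated W = UNIV" using irr unfolding rep_irreducible_def by blast
  thus "W = fixed K" using generated_fixed[of W] W by simp
qed

lemma stable_rep:
  assumes stable: "\<And>\<gamma>. \<gamma> \<in> tw_points X \<Longrightarrow> \<tau> \<gamma> ` U = U" and "g \<in> carrier G" "u \<in> U"
  shows "\<pi> g u \<in> U"
proof -
  obtain w where w: "w \<in> U" "u = \<tau> \<delta> w" using stable[OF base] assms(3) by blast
  hence "\<pi> g u = \<tau> (lact g \<delta>) w" using tw_lact[OF assms(2) base] by simp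
  thus ?thesis using stable[OF lact_closed[OF assms(2) base]] w(1) by blast
qed

text \<open>The fixed vectors in \<open>U\<close> form a nonzero submodule stable under \<open>\<Pi>(\<delta>)\<close>.\<close>

lemma simple_imp_contained:
  assumes simple: "simple_tw_module G X M \<omega> K V" and U: "subspace U"
    and stable: "\<And>\<gamma>. \<gamma> \<in> tw_points X \<Longrightarrow> \<tau> \<gamma> ` U = U" and ne: "U \<inter> fixed K \<noteq> {0}"
  shows "fixed K \<subseteq> U"
proof -
  have "act f w \<in> U \<inter> fixed K" if f: "f \<in> hecke G K" and w: "w \<in> U \<inter> fixed K" for f w
  proof
    obtain S where S: "adapted K S f"
      using rinv_cpt_adapted[OF K hecke_rinv_cpt[OF K f]] .
    have "act f w = (\<Sum>s\<in>S. sc (complex_of_real (measure M K)) (sc (f s) (\<pi> s w)))"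
      using act_adapted[OF S] w by blast
    also have "\<dots> \<in> U"
      using stable_rep[OF stable] adapted_self(3)[OF S] w
      by (intro subspace_sum[OF U] subspace_scale[OF U]) blast
    finally show "act f w \<in> U" .
    show "act f w \<in> fixed K"
      using act_fixed[OF K hecke_smooth_cpt[OF K f] hecke_left_inv[OF K f]] .
  qed
  hence sub: "hecke_submodule G K V (U \<inter> fixed K)"
    unfolding hecke_submodule_iff using subspace_inter[OF U subspace_fixed[OF KD(5)]] by simp
  have "\<tau> \<delta> ` (U \<inter> fixed K) = U \<inter> fixed K"
    unfolding image_Int[OF bij_is_inj[OF tw_bij[OF base]]] stable[OF base] base_fixed ..
  hence "U \<inter> fixed K = fixed K"
    using simple sub ne unfolding simple_iff by blast
  thus ?thesis by blast
qed

end

section \<open>Correspondences between irreducible representations\<close>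

text \<open>The direct sum of two representations, in which graphs of morphisms are subspaces.\<close>

definition prod_rep ::
  "('g, 'x, 'v) tw_rep \<Rightarrow> ('g, 'x, 'w) tw_rep \<Rightarrow> ('g, 'x, 'v \<times> 'w) tw_rep" where
  "prod_rep R1 R2 =
     \<lparr> rep_scale = (\<lambda>c. map_prod (rep_scale R1 c) (rep_scale R2 c)),
       rep_grp = (\<lambda>g. map_prod (rep_grp R1 g) (rep_grp R2 g)),
       rep_tw = (\<lambda>\<gamma>. map_prod (rep_tw R1 \<gamma>) (rep_tw R2 \<gamma>)) \<rparr>"

lemma prod_rep_simps [simp]:
  "rep_scale (prod_rep R1 R2) c (v, w) = (rep_scale R1 c v, rep_scale R2 c w)"
  "rep_grp (prod_rep R1 R2) g (v, w) = (rep_grp R1 g v, rep_grp R2 g w)"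
  "rep_tw (prod_rep R1 R2) \<gamma> (v, w) = (rep_tw R1 \<gamma> v, rep_tw R2 \<gamma> w)"
  by (simp_all add: prod_rep_def)

lemma prod_rep_sel:
  "rep_scale (prod_rep R1 R2) c p = (rep_scale R1 c (fst p), rep_scale R2 c (snd p))"
  "rep_grp (prod_rep R1 R2) g p = (rep_grp R1 g (fst p), rep_grp R2 g (snd p))"
  "rep_tw (prod_rep R1 R2) \<gamma> p = (rep_tw R1 \<gamma> (fst p), rep_tw R2 \<gamma> (snd p))"
  by (simp_all add: prod_rep_def map_prod_def case_prod_beta)

lemma vector_space_prod_rep:
  fixes R1 :: "('g, 'x, 'v::ab_group_add) tw_rep" and R2 :: "('g, 'x, 'w::ab_group_add) tw_rep"
  assumes "vector_space (rep_scale R1)" "vector_space (rep_scale R2)"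
  shows "vector_space (rep_scale (prod_rep R1 R2))"
proof -
  interpret a: vector_space "rep_scale R1" by fact
  interpret b: vector_space "rep_scale R2" by fact
  show ?thesis
    by unfold_locales
      (simp_all add: prod_rep_sel a.scale_right_distrib b.scale_right_distrib
        a.scale_left_distrib b.scale_left_distrib)
qed

lemma linear_map_prod:
  fixes R1 :: "('g, 'x, 'v::ab_group_add) tw_rep" and R2 :: "('g, 'x, 'w::ab_group_add) tw_rep"
  assumes "Vector_Spaces.linear (rep_scale R1) (rep_scale R1) f"
    and "Vector_Spaces.linear (rep_scale R2) (rep_scale R2) h"
  shows "Vector_Spaces.linear (rep_scale (prod_rep R1 R2)) (rep_scale (prod_rep R1 R2)) (map_prod f h)"
  using assms vector_space_prod_rep[of R1 R2]
  unfolding Vector_Spaces.linear_iff by (simp add: prod_rep_sel map_prod_def case_prod_beta)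

lemma smooth_omega_rep_prod:
  fixes R1 :: "('g, 'x, 'v::ab_group_add) tw_rep" and R2 :: "('g, 'x, 'w::ab_group_add) tw_rep"
  assumes R1: "smooth_omega_rep G X \<omega> R1" and R2: "smooth_omega_rep G X \<omega> R2"
  shows "smooth_omega_rep G X \<omega> (prod_rep R1 R2)"
proof -
  have s1: "smooth_rep G (rep_scale R1) (rep_grp R1)" and s2: "smooth_rep G (rep_scale R2) (rep_grp R2)"
    using R1 R2 by (simp_all add: smooth_omega_rep_def)
  have grp: "rep_grp (prod_rep R1 R2) g = map_prod (rep_grp R1 g) (rep_grp R2 g)"
    and tw: "rep_tw (prod_rep R1 R2) \<gamma> = map_prod (rep_tw R1 \<gamma>) (rep_tw R2 \<gamma>)" for g \<gamma>
    by (simp_all add: prod_rep_def)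
  have "openin (grp_top G) {g \<in> carrier G. rep_grp (prod_rep R1 R2) g v = v}" for v
  proof -
    have "{g \<in> carrier G. rep_grp (prod_rep R1 R2) g v = v}
        = {g \<in> carrier G. rep_grp R1 g (fst v) = fst v} \<inter> {g \<in> carrier G. rep_grp R2 g (snd v) = snd v}"
      by (auto simp: prod_rep_sel prod_eq_iff)
    thus ?thesis using s1 s2 by (simp add: smooth_rep_def openin_Int)
  qed
  moreover have "Vector_Spaces.linear (rep_scale (prod_rep R1 R2)) (rep_scale (prod_rep R1 R2))
      (rep_grp (prod_rep R1 R2) g)" if "g \<in> carrier G" for g
    unfolding grp using s1 s2 that by (intro linear_map_prod) (simp_all add: smooth_rep_def)
  ultimately have "smooth_rep G (rep_scale (prod_rep R1 R2)) (rep_grp (prod_rep R1 R2))"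
    using s1 s2 vector_space_prod_rep[of R1 R2] by (simp add: smooth_rep_def prod_rep_sel)
  moreover have "Vector_Spaces.linear (rep_scale (prod_rep R1 R2)) (rep_scale (prod_rep R1 R2))
      (rep_tw (prod_rep R1 R2) \<gamma>)" "bij (rep_tw (prod_rep R1 R2) \<gamma>)" if "\<gamma> \<in> tw_points X" for \<gamma>
  proof -
    have g: "Vector_Spaces.linear (rep_scale R1) (rep_scale R1) (rep_tw R1 \<gamma>)" "bij (rep_tw R1 \<gamma>)"
      "Vector_Spaces.linear (rep_scale R2) (rep_scale R2) (rep_tw R2 \<gamma>)" "bij (rep_tw R2 \<gamma>)"
      using R1 R2 that by (simp_all add: smooth_omega_rep_def)
    show "Vector_Spaces.linear (rep_scale (prod_rep R1 R2)) (rep_scale (prod_rep R1 R2))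
      (rep_tw (prod_rep R1 R2) \<gamma>)" unfolding tw by (rule linear_map_prod[OF g(1,3)])
    show "bij (rep_tw (prod_rep R1 R2) \<gamma>)"
      unfolding tw
      by (rule bijI[OF prod.inj_map[OF bij_is_inj[OF g(2)] bij_is_inj[OF g(4)]]
            map_prod_surj[OF bij_is_surj[OF g(2)] bij_is_surj[OF g(4)]]])
  qed
  ultimately show ?thesis
    using R1 R2 unfolding smooth_omega_rep_def by (simp add: prod_rep_sel)
qed

locale twisted_pair = twisted_level G M X \<omega> K \<delta> +
  r1: twisted_rep G M X \<omega> K \<delta> R1 + r2: twisted_rep G M X \<omega> K \<delta> R2
  for G :: "'g top_group" (structure) and M and X :: "('g, 'x) twisted" and \<omega> K \<delta>
  and R1 :: "('g, 'x, 'v::ab_group_add) tw_rep" and R2 :: "('g, 'x, 'w::ab_group_add) tw_rep"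
begin

sublocale p: twisted_rep G M X \<omega> K \<delta> "prod_rep R1 R2"
  by unfold_locales (rule smooth_omega_rep_prod[OF r1.omega_rep r2.omega_rep])

lemma prod_fixed: "p.fixed K = r1.fixed K \<times> r2.fixed K"
  unfolding p.fixed_def r1.fixed_def r2.fixed_def by auto

lemma fst_linear: "Vector_Spaces.linear p.sc r1.sc fst"
  and snd_linear: "Vector_Spaces.linear p.sc r2.sc snd"
  using p.vector_space_axioms r1.vector_space_axioms r2.vector_space_axioms
  by (simp_all add: Vector_Spaces.linear_iff prod_rep_sel)

lemma prod_act:
  assumes "smooth_cpt f"
  shows "p.act f (v, w) = (r1.act f v, r2.act f w)"
proof -
  note lin = lc_integral_linear[OF p.smooth_cpt_act[OF assms, of "(v, w)"] fst_linear]
    lc_integral_linear[OF p.smooth_cpt_act[OF assms, of "(v, w)"] snd_linear]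
  have "r1.act f v = fst (p.act f (v, w))" "r2.act f w = snd (p.act f (v, w))"
    using lin by (simp_all add: hecke_act_def)
  thus ?thesis by simp
qed

lemma stable_subspace_trivial:
  shows "rep_irreducible X R1 \<Longrightarrow> r1.subspace U \<Longrightarrow>
      (\<And>\<gamma>. \<gamma> \<in> tw_points X \<Longrightarrow> r1.\<tau> \<gamma> ` U = U) \<Longrightarrow> U = {0} \<or> U = UNIV"
    and "rep_irreducible X R2 \<Longrightarrow> r2.subspace U' \<Longrightarrow>
      (\<And>\<gamma>. \<gamma> \<in> tw_points X \<Longrightarrow> r2.\<tau> \<gamma> ` U' = U') \<Longrightarrow> U' = {0} \<or> U' = UNIV"
  unfolding rep_irreducible_def by blast+

text \<open>Goursat's argument. The kernels and the images of the two projections of \<open>Z\<close> are stable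
  subspaces of irreducible representations; the hypotheses force the kernels to vanish and the
  images to be everything, so \<open>Z\<close> is the graph of an isomorphism.\<close>

lemma stable_correspondence:
  assumes irr: "rep_irreducible X R1" "rep_irreducible X R2"
    and Z: "p.subspace Z" "\<And>\<gamma>. \<gamma> \<in> tw_points X \<Longrightarrow> p.\<tau> \<gamma> ` Z = Z"
    and proper: "\<exists>v. (v, 0) \<notin> Z" "\<exists>w. (0, w) \<notin> Z"
    and nonzero: "\<exists>z\<in>Z. fst z \<noteq> 0" "\<exists>z\<in>Z. snd z \<noteq> 0"
  shows "rep_isomorphic X R1 R2"
proof -
  have mem: "p.\<tau> \<gamma> z \<in> Z \<longleftrightarrow> z \<in> Z" if g: "\<gamma> \<in> tw_points X" for \<gamma> z
  proof -
    have "inj (p.\<tau> \<gamma>)" using bij_is_inj[OF p.tw_bij[OF g]] .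
    from inj_image_mem_iff[OF this, of z Z] show ?thesis unfolding Z(2)[OF g] .
  qed
  have stable1: "r1.\<tau> \<gamma> ` {v. (v, 0) \<in> Z} = {v. (v, 0) \<in> Z}"
    and stable2: "r2.\<tau> \<gamma> ` {w. (0, w) \<in> Z} = {w. (0, w) \<in> Z}"
    and stable3: "r1.\<tau> \<gamma> ` (fst ` Z) = fst ` Z"
    and stable4: "r2.\<tau> \<gamma> ` (snd ` Z) = snd ` Z" if g: "\<gamma> \<in> tw_points X" for \<gamma>
  proof -
    have "(r1.\<tau> \<gamma> v, 0) \<in> Z \<longleftrightarrow> (v, 0) \<in> Z" for v
      using mem[OF g, of "(v, 0)"] r2.tw_simps(3)[OF g] by simp
    moreover have "surj (r1.\<tau> \<gamma>)" using bij_is_surj[OF r1.tw_bij[OF g]] .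
    ultimately show "r1.\<tau> \<gamma> ` {v. (v, 0) \<in> Z} = {v. (v, 0) \<in> Z}"
      by (auto simp: image_iff) (metis surjD)
    have "(0, r2.\<tau> \<gamma> w) \<in> Z \<longleftrightarrow> (0, w) \<in> Z" for w
      using mem[OF g, of "(0, w)"] r1.tw_simps(3)[OF g] by simp
    moreover have "surj (r2.\<tau> \<gamma>)" using bij_is_surj[OF r2.tw_bij[OF g]] .
    ultimately show "r2.\<tau> \<gamma> ` {w. (0, w) \<in> Z} = {w. (0, w) \<in> Z}"
      by (auto simp: image_iff) (metis surjD)
    have "fst ` p.\<tau> \<gamma> ` Z = r1.\<tau> \<gamma> ` (fst ` Z)" "snd ` p.\<tau> \<gamma> ` Z = r2.\<tau> \<gamma> ` (snd ` Z)"
      by (simp_all add: image_image prod_rep_sel)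
    thus "r1.\<tau> \<gamma> ` (fst ` Z) = fst ` Z" "r2.\<tau> \<gamma> ` (snd ` Z) = snd ` Z"
      unfolding Z(2)[OF g] by simp_all
  qed
  have Zadd: "(a + a', b + b') \<in> Z" if "(a, b) \<in> Z" "(a', b') \<in> Z" for a a' b b'
    using p.subspace_add[OF Z(1) that] by simp
  have Zscale: "(r1.sc c a, r2.sc c b) \<in> Z" if "(a, b) \<in> Z" for a b c
    using p.subspace_scale[OF Z(1) that, of c] by simp
  have Zzero: "(0, 0) \<in> Z" using p.subspace_0[OF Z(1)] by (simp add: zero_prod_def)
  have Zdiff: "(a - a', b - b') \<in> Z" if "(a, b) \<in> Z" "(a', b') \<in> Z" for a a' b b'
    using p.subspace_diff[OF Z(1) that] by simp
  have "r1.subspace {v. (v, 0) \<in> Z}"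
    using Zadd[of _ 0 _ 0] Zscale[of _ 0] Zzero by (simp add: r1.subspace_def)
  hence ker1: "{v. (v, 0) \<in> Z} = {0}"
    using stable_subspace_trivial(1)[OF irr(1) _ stable1] proper(1) by blast
  have "r2.subspace {w. (0, w) \<in> Z}"
    using Zadd[of 0 _ 0] Zscale[of 0] Zzero by (simp add: r2.subspace_def)
  hence ker2: "{w. (0, w) \<in> Z} = {0}"
    using stable_subspace_trivial(2)[OF irr(2) _ stable2] proper(2) by blast
  have "r1.subspace (fst ` Z)"
  proof -
    interpret Vector_Spaces.linear p.sc r1.sc fst by (rule fst_linear)
    show ?thesis by (rule subspace_image[OF Z(1)])
  qed
  hence im1: "fst ` Z = UNIV"
    using stable_subspace_trivial(1)[OF irr(1) _ stable3] nonzero(1) by blast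
  have "r2.subspace (snd ` Z)"
  proof -
    interpret Vector_Spaces.linear p.sc r2.sc snd by (rule snd_linear)
    show ?thesis by (rule subspace_image[OF Z(1)])
  qed
  hence im2: "snd ` Z = UNIV"
    using stable_subspace_trivial(2)[OF irr(2) _ stable4] nonzero(2) by blast
  have right_unique: "b = b'" if "(a, b) \<in> Z" "(a, b') \<in> Z" for a b b'
  proof -
    have "b - b' \<in> {w. (0, w) \<in> Z}" using Zdiff[OF that] by simp
    thus ?thesis unfolding ker2 by simp
  qed
  have left_unique: "a = a'" if "(a, b) \<in> Z" "(a', b) \<in> Z" for a a' b
  proof -
    have "a - a' \<in> {v. (v, 0) \<in> Z}" using Zdiff[OF that] by simp
    thus ?thesis unfolding ker1 by simp
  qed
  define B where "B v = (SOME w. (v, w) \<in> Z)" for v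
  have "\<exists>w. (v, w) \<in> Z" for v
  proof -
    have "v \<in> fst ` Z" using im1 by simp
    thus ?thesis by force
  qed
  hence BZ: "(v, B v) \<in> Z" for v unfolding B_def by (rule someI_ex)
  have B: "B v = w" if "(v, w) \<in> Z" for v w using right_unique[OF BZ that] .
  have "Vector_Spaces.linear r1.sc r2.sc B"
    unfolding Vector_Spaces.linear_iff
    using r1.vector_space_axioms r2.vector_space_axioms B[OF Zadd[OF BZ BZ]] B[OF Zscale[OF BZ]]
    by simp
  moreover have "B (r1.\<tau> \<gamma> v) = r2.\<tau> \<gamma> (B v)" if "\<gamma> \<in> tw_points X" for \<gamma> v
    using mem[OF that, of "(v, B v)"] BZ by (intro B) simp
  moreover have "bij B"
  proof (rule bijI)
    show "inj B" using left_unique BZ by (metis injI)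
    have "\<exists>v. w = B v" for w
    proof -
      have "w \<in> snd ` Z" using im2 by simp
      then obtain v where "(v, w) \<in> Z" by force
      thus ?thesis using B by metis
    qed
    thus "surj B" by (simp add: surj_def)
  qed
  ultimately show ?thesis unfolding rep_isomorphic_def rep_morphism_def by blast
qed

text \<open>The graph \<open>\<Gamma>\<close> of \<open>A\<close> is a submodule of the fixed vectors of the direct sum, and the subspace it
  generates contains no further fixed vectors. It therefore cannot contain \<open>(v, 0)\<close> or
  \<open>(0, A v)\<close> for a nonzero fixed vector \<open>v\<close>, so it is a correspondence as in
  \<open>stable_correspondence\<close>.\<close>

lemma module_iso_imp_rep_iso:
  assumes irr: "rep_irreducible X R1" "rep_irreducible X R2"
    and ne: "r1.fixed K \<noteq> {0}" and iso: "tw_module_isomorphic G X K r1.V r2.V"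
  shows "rep_isomorphic X R1 R2"
proof -
  obtain A where A: "tw_module_morphism G X K r1.V r2.V A" and bij: "bij_betw A (r1.fixed K) (r2.fixed K)"
    using iso unfolding tw_module_isomorphic_def r1.fixed_module_simps(2) r2.fixed_module_simps(2) by blast
  note A' = A[unfolded tw_module_morphism_def r1.fixed_module_simps(1-3) r2.fixed_module_simps(1-3)]
  have A_closed: "A v \<in> r2.fixed K" and A_scale: "A (r1.sc c v) = r2.sc c (A v)"
    and A_act: "f \<in> hecke G K \<Longrightarrow> A (r1.act f v) = r2.act f (A v)"
    and A_tw: "\<phi> \<in> tw_hecke X K \<Longrightarrow> A (mod_tw r1.V \<phi> v) = mod_tw r2.V \<phi> (A v)"
    if "v \<in> r1.fixed K" for v c f \<phi>
    using A' that by blast+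
  have A_add: "A (v + w) = A v + A w" if "v \<in> r1.fixed K" "w \<in> r1.fixed K" for v w
    using A' that by blast
  have zero: "0 \<in> r1.fixed K" using r1.subspace_0[OF r1.subspace_fixed[OF KD(5)]] .
  have A_zero: "A 0 = 0" using A_scale[OF zero, of 0] by simp
  have A_base: "A (r1.\<tau> \<delta> v) = r2.\<tau> \<delta> (A v)" if "v \<in> r1.fixed K" for v
    using A_tw[OF that tw_unit_hecke] r1.mod_tw_unit[OF that] r2.mod_tw_unit[OF A_closed[OF that]] by simp
  define \<Gamma> where "\<Gamma> = (\<lambda>v. (v, A v)) ` r1.fixed K"
  have graph: "(v, w) \<in> \<Gamma> \<longleftrightarrow> v \<in> r1.fixed K \<and> w = A v" for v w by (auto simp: \<Gamma>_def)
  have "p.subspace \<Gamma>"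
    using r1.subspace_fixed[OF KD(5)] A_zero A_add A_scale
    by (auto simp: p.subspace_def r1.subspace_def graph zero_prod_def)
  moreover have "p.act f z \<in> \<Gamma>" if f: "f \<in> hecke G K" and z: "z \<in> \<Gamma>" for f z
  proof -
    obtain v where v: "v \<in> r1.fixed K" "z = (v, A v)" using z by (auto simp: \<Gamma>_def)
    have "r1.act f v \<in> r1.fixed K"
      using r1.act_fixed[OF K hecke_smooth_cpt[OF K f] hecke_left_inv[OF K f]] .
    thus ?thesis
      unfolding v(2) prod_act[OF hecke_smooth_cpt[OF K f]] graph using A_act[OF v(1) f] by simp
  qed
  moreover have "\<Gamma> \<subseteq> p.fixed K" using A_closed by (auto simp: \<Gamma>_def prod_fixed)
  ultimately have sub: "hecke_submodule G K p.V \<Gamma>" by (simp add: p.hecke_submodule_iff)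
  have "p.\<tau> \<delta> ` \<Gamma> = (\<lambda>v. (r1.\<tau> \<delta> v, r2.\<tau> \<delta> (A v))) ` r1.fixed K"
    by (simp add: \<Gamma>_def image_image)
  also have "\<dots> = (\<lambda>v. (r1.\<tau> \<delta> v, A (r1.\<tau> \<delta> v))) ` r1.fixed K"
    using A_base by (intro image_cong) simp_all
  also have "\<dots> = (\<lambda>v. (v, A v)) ` r1.\<tau> \<delta> ` r1.fixed K" by (simp add: image_image)
  finally have base_graph: "p.\<tau> \<delta> ` \<Gamma> = \<Gamma>" unfolding r1.base_fixed \<Gamma>_def .
  have fixed_part: "(v, w) \<in> p.generated \<Gamma> \<Longrightarrow> v \<in> r1.fixed K \<Longrightarrow> w \<in> r2.fixed K \<Longrightarrow> w = A v" for v w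
    using p.generated_fixed[OF sub] graph[of v w] by (auto simp: prod_fixed)
  obtain v where v: "v \<in> r1.fixed K" "v \<noteq> 0" using ne zero by blast
  have Av: "A v \<noteq> 0"
  proof
    assume "A v = 0"
    hence "A v = A 0" using A_zero by simp
    thus False using bij_betw_imp_inj_on[OF bij] v zero by (auto dest: inj_onD)
  qed
  have "(v, A v) \<in> p.generated \<Gamma>"
    using p.generated_superset[OF sub] v(1) by (auto simp: \<Gamma>_def)
  hence nonzero: "\<exists>z\<in>p.generated \<Gamma>. fst z \<noteq> 0" "\<exists>z\<in>p.generated \<Gamma>. snd z \<noteq> 0"
    using v(2) Av by force+
  have "(v, 0) \<notin> p.generated \<Gamma>"
    using fixed_part[OF _ v(1) A_closed[OF zero, unfolded A_zero]] Av by metis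
  moreover have "(0, A v) \<notin> p.generated \<Gamma>"
    using fixed_part[OF _ zero A_closed[OF v(1)]] Av A_zero by metis
  moreover have "p.subspace (p.generated \<Gamma>)" by (simp add: p.generated_def)
  ultimately show ?thesis
    using stable_correspondence[OF irr _ p.generated_tw_stable[OF base_graph] _ _ nonzero] by blast
qed

text \<open>An isomorphism commutes with all \<open>\<Pi>(\<gamma>)\<close>, hence with \<open>\<pi>(g)\<close>, which is \<open>\<Pi>(g \<delta>)\<close> composed with
  the inverse of \<open>\<Pi>(\<delta>)\<close>, and then with every integral of these operators.\<close>

lemma rep_iso_imp_module_iso:
  assumes iso: "rep_isomorphic X R1 R2"
  shows "tw_module_isomorphic G X K r1.V r2.V"
proof -
  obtain A where lin: "Vector_Spaces.linear r1.sc r2.sc A" and "bij A"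
    and A_tw: "\<And>\<gamma> v. \<gamma> \<in> tw_points X \<Longrightarrow> A (r1.\<tau> \<gamma> v) = r2.\<tau> \<gamma> (A v)"
    using iso unfolding rep_isomorphic_def rep_morphism_def by blast
  interpret A: Vector_Spaces.linear r1.sc r2.sc A by (rule lin)
  have A_rep: "A (r1.\<pi> g v) = r2.\<pi> g (A v)" if g: "g \<in> carrier G" for g v
  proof -
    obtain u where u: "v = r1.\<tau> \<delta> u" using bij_is_surj[OF r1.tw_bij[OF base]] by blast
    have "A (r1.\<pi> g v) = A (r1.\<tau> (lact g \<delta>) u)" using r1.tw_lact[OF g base] u by simp
    also have "\<dots> = r2.\<pi> g (A v)"
      using A_tw[OF lact_closed[OF g base]] A_tw[OF base] r2.tw_lact[OF g base] u by simp
    finally show ?thesis .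
  qed
  have A_act: "A (r1.act f v) = r2.act f (A v)" if f: "smooth_cpt f" for f v
  proof -
    have "A (r1.act f v) = lc_integral M r2.sc (\<lambda>g. A (r1.sc (f g) (r1.\<pi> g v)))"
      unfolding hecke_act_def using lc_integral_linear[OF r1.smooth_cpt_act[OF f] lin] by simp
    also have "\<dots> = r2.act f (A v)"
      unfolding hecke_act_def by (rule lc_integral_cong) (simp add: A.scale A_rep)
    finally show ?thesis .
  qed
  have A_mod: "A (mod_tw r1.V \<phi> v) = mod_tw r2.V \<phi> (A v)" if "\<phi> \<in> tw_hecke X K" for \<phi> v
    using tw_hecke_tw_cpt[OF that]
    by (simp add: r1.mod_tw_pull r2.mod_tw_pull A_tw[OF base] A_act pull_smooth)
  have inj: "inj A" and surj: "surj A" using \<open>bij A\<close> by (simp_all add: bij_def)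
  have fixed_iff: "A v \<in> r2.fixed K \<longleftrightarrow> v \<in> r1.fixed K" for v
    using A_rep KD(6) inj_eq[OF inj] by (simp add: r1.fixed_def r2.fixed_def flip: A_rep)
  have image: "A ` r1.fixed K = r2.fixed K"
  proof (intro equalityI subsetI)
    fix w assume w: "w \<in> r2.fixed K"
    obtain v where "w = A v" using surj by blast
    thus "w \<in> A ` r1.fixed K" using w fixed_iff by blast
  qed (use fixed_iff in blast)
  hence "bij_betw A (r1.fixed K) (r2.fixed K)"
    using inj_on_subset[OF inj subset_UNIV] by (simp add: bij_betw_def)
  moreover have "tw_module_morphism G X K r1.V r2.V A"
    unfolding tw_module_morphism_def r1.fixed_module_simps(1-3) r2.fixed_module_simps(1-3)
    using image A.add A.scale A_act hecke_smooth_cpt[OF K] A_mod by simp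
  ultimately show ?thesis
    unfolding tw_module_isomorphic_def r1.fixed_module_simps(2) r2.fixed_module_simps(2) by blast
qed

end

section \<open>Irreducibility and isomorphism in terms of fixed vectors\<close>

theorem proposition1:
  fixes G :: "'g top_group"
    and X :: "('g, 'x) twisted"
    and M :: "'g measure"
    and \<omega> :: "'g \<Rightarrow> complex"
    and \<K> :: "'g set set"
  assumes "locally_profinite G"
    and "left_haar_measure G M"
    and "twisted_space G X"
    and "grp_character G \<omega>"
    and "\<And>K. K \<in> \<K> \<Longrightarrow> compact_open_subgroup G K"
    and "\<And>U. openin (grp_top G) U \<Longrightarrow> \<one>\<^bsub>G\<^esub> \<in> U \<Longrightarrow> \<exists>K\<in>\<K>. K \<subseteq> U"
    and "\<And>K k. K \<in> \<K> \<Longrightarrow> k \<in> K \<Longrightarrow> \<omega> k = 1"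
    and "\<And>K. K \<in> \<K> \<Longrightarrow> \<exists>\<delta>\<in>tw_points X. tw_int X \<delta> ` K = K"
  shows "(\<forall>R :: ('g, 'x, 'v::ab_group_add) tw_rep.
            smooth_omega_rep G X \<omega> R \<longrightarrow>
            (rep_irreducible X R \<longleftrightarrow>
               (UNIV :: 'v set) \<noteq> {0} \<and>
               (\<forall>K\<in>\<K>. mod_carrier (fixed_module X M R K) = {0} \<or>
                      simple_tw_module G X M \<omega> K (fixed_module X M R K)))) \<and>
         (\<forall>(R1 :: ('g, 'x, 'v1::ab_group_add) tw_rep)
           (R2 :: ('g, 'x, 'v2::ab_group_add) tw_rep) K.
            smooth_omega_rep G X \<omega> R1 \<and> rep_irreducible X R1 \<and>
            smooth_omega_rep G X \<omega> R2 \<and> rep_irreducible X R2 \<and>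
            K \<in> \<K> \<and> fixed_vectors R1 K \<noteq> {0} \<and> fixed_vectors R2 K \<noteq> {0} \<longrightarrow>
            (rep_isomorphic X R1 R2 \<longleftrightarrow>
               tw_module_isomorphic G X K (fixed_module X M R1 K) (fixed_module X M R2 K)))"
proof (intro conjI allI impI)
  have level: "\<exists>\<delta>. twisted_level G M X \<omega> K \<delta>" if K: "K \<in> \<K>" for K
  proof -
    obtain \<delta> where "\<delta> \<in> tw_points X" "tw_int X \<delta> ` K = K" using assms(8)[OF K] by blast
    thus ?thesis using assms(1-4) assms(5,7)[OF K]
      by (intro exI[of _ \<delta>] twisted_level.intro twisted_group.intro haar_group.intro
          twisted_group_axioms.intro twisted_level_axioms.intro) simp_all
  qed
  have rep: "\<exists>\<delta>. twisted_rep G M X \<omega> K \<delta> R"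
    if K: "K \<in> \<K>" and R: "smooth_omega_rep G X \<omega> R"
    for K and R :: "('g, 'x, 'u::ab_group_add) tw_rep"
    using level[OF K] R by (metis twisted_rep.intro twisted_rep_axioms.intro)
  {
    fix R :: "('g, 'x, 'v) tw_rep"
    assume R: "smooth_omega_rep G X \<omega> R"
    show "rep_irreducible X R \<longleftrightarrow> (UNIV :: 'v set) \<noteq> {0} \<and>
        (\<forall>K\<in>\<K>. mod_carrier (fixed_module X M R K) = {0} \<or>
               simple_tw_module G X M \<omega> K (fixed_module X M R K))"
    proof (intro iffI conjI ballI)
      assume irr: "rep_irreducible X R"
      thus "(UNIV :: 'v set) \<noteq> {0}" by (simp add: rep_irreducible_def)
      fix K assume K: "K \<in> \<K>"
      obtain \<delta> where "twisted_rep G M X \<omega> K \<delta> R" using rep[OF K R] by blast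
      then interpret twisted_rep G M X \<omega> K \<delta> R .
      show "mod_carrier V = {0} \<or> simple_tw_module G X M \<omega> K V"
        using irreducible_imp_simple[OF irr] unfolding fixed_module_simps(2) by blast
    next
      assume H: "(UNIV :: 'v set) \<noteq> {0} \<and>
        (\<forall>K\<in>\<K>. mod_carrier (fixed_module X M R K) = {0} \<or>
               simple_tw_module G X M \<omega> K (fixed_module X M R K))"
      have "U = UNIV" if U: "module.subspace (rep_scale R) U" "U \<noteq> {0}"
        and stable: "\<forall>\<gamma>\<in>tw_points X. rep_tw R \<gamma> ` U = U" for U
      proof -
        have sr: "smooth_rep G (rep_scale R) (rep_grp R)" using R by (simp add: smooth_omega_rep_def)
        interpret haar_rep G M "rep_scale R" "rep_grp R"
          using assms(1,2) sr by unfold_locales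
        obtain u where u: "u \<in> U" "u \<noteq> 0" using U subspace_0[OF U(1)] by blast
        have "v \<in> U" for v
        proof -
          \<comment> \<open>one level \<open>K\<close> has to see both the given vector \<open>v\<close> and a nonzero vector of \<open>U\<close>\<close>
          let ?S = "{g \<in> carrier G. rep_grp R g u = u} \<inter> {g \<in> carrier G. rep_grp R g v = v}"
          have "openin (grp_top G) ?S" "\<one>\<^bsub>G\<^esub> \<in> ?S"
            using stabilizer_open by (auto simp: rep_one)
          then obtain K where K: "K \<in> \<K>" "K \<subseteq> ?S" using assms(6) by blast
          obtain \<delta> where "twisted_rep G M X \<omega> K \<delta> R" using rep[OF K(1) R] by blast
          then interpret K: twisted_rep G M X \<omega> K \<delta> R .
          have uv: "u \<in> fixed K" "v \<in> fixed K" using K(2) by (auto simp: fixed_def)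
          hence "fixed K \<noteq> {0}" using u(2) by blast
          hence simple: "simple_tw_module G X M \<omega> K K.V"
            using bspec[OF conjunct2[OF H] K(1)] by (simp add: K.fixed_module_simps(2))
          have "U \<inter> fixed K \<noteq> {0}" using u uv(1) by blast
          from subsetD[OF K.simple_imp_contained[OF simple U(1) bspec[OF stable] this] uv(2)]
          show ?thesis .
        qed
        thus ?thesis by blast
      qed
      thus "rep_irreducible X R" using H unfolding rep_irreducible_def by blast
    qed
  }
  fix R1 :: "('g, 'x, 'v1) tw_rep" and R2 :: "('g, 'x, 'v2) tw_rep" and K
  assume H: "smooth_omega_rep G X \<omega> R1 \<and> rep_irreducible X R1 \<and>
            smooth_omega_rep G X \<omega> R2 \<and> rep_irreducible X R2 \<and>
            K \<in> \<K> \<and> fixed_vectors R1 K \<noteq> {0} \<and> fixed_vectors R2 K \<noteq> {0}"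
  then obtain \<delta> where "twisted_level G M X \<omega> K \<delta>" using level by blast
  hence "twisted_pair G M X \<omega> K \<delta> R1 R2"
    using H by (intro twisted_pair.intro twisted_rep.intro twisted_rep_axioms.intro) simp_all
  then interpret twisted_pair G M X \<omega> K \<delta> R1 R2 .
  have "r1.fixed K \<noteq> {0}" using H by (simp add: fixed_vectors_def r1.fixed_def)
  thus "rep_isomorphic X R1 R2 \<longleftrightarrow> tw_module_isomorphic G X K r1.V r2.V"
    using H module_iso_imp_rep_iso rep_iso_imp_module_iso by blast
qed

end
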